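(* Let $\rho_0\in L^\infty$ be supported in $\overline{B_1}$ with $\int_{\partial B_r}\rho_0\,dS_r=0$ for almost every $r>0$, let $\rho$ be the corresponding solution, and fix $\kappa\in(0,1)$. (i) If $\rho_0$ (restricted to $\overline{B_1}$) belongs to $C(\overline{B_1})$, then there exist an absolute constant $C>0$ and a constant $\widetilde C$ depending on $\rho_0$ and $\kappa$ such that $\mathcal G(\rho(t,\cdot))\le \frac{C}{\kappa^2}\,t^{-1}$ for all $t\ge\widetilde C$. (ii) If $\rho_0\in\dot W^{\alpha,1}(B_1)$ for some $\alpha\in(0,1]$, then there exist constants $C_1,C_2$ depending only on $\alpha,\kappa,\|\rho_0\|_{\dot W^{\alpha,1}(B_1)},\|\rho_0\|_{L^\infty}$ such that $\mathcal G(\rho(t,\cdot))\le C_1t^{-\alpha/2}$ for all $t\ge C_2$.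
   Context: $B_1\subset\mathbb R^2$ open unit disk, $B_r(x)$ open disk of radius $r$ centered at $x$, $B_r=B_r(0)$, polar coordinates $(r,\theta)$, $dS_r$ arc-length on $\partial B_r$. Velocity $u(r,\theta)=2\pi r^2(\sin\theta,-\cos\theta)$; $\rho(t,\cdot)$ solves $\partial_t\rho+\operatorname{div}(u\rho)=0$, $\rho(0)=\rho_0$, explicitly $\rho(t,r,\theta)=\rho_0(r,\theta+2\pi tr)$. Geometric mixing scale with accuracy $\kappa$: for bounded $f$ supported in $\overline{B_1}$ (extended by zero), $\mathcal G(f)$ is the infimum of $\varepsilon>0$ such that $\big|\frac1{|B_\varepsilon|}\int_{B_\varepsilon(x)}f\big|\le\kappa\|f\|_{L^\infty(B_1)}$ for all $x\in\mathbb R^2$. Seminorms: for $\alpha\in(0,1)$, $\|f\|_{\dot W^{\alpha,1}(B_1)}=\iint_{B_1\times B_1}\frac{|f(x)-f(y)|}{|x-y|^{2+\alpha}}dx\,dy$; for $\alpha=1$, $\|f\|_{\dot W^{1,1}(B_1)}=\|\nabla f\|_{L^1(B_1)}$. *)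

theory Defs
  imports "HOL-Analysis.Analysis"
begin

text \<open>The plane R^2 is modelled by the type complex (with Lebesgue measure lborel).
  A point with polar coordinates (r, theta) is r * cis theta.\<close>

text \<open>Explicit solution of the transport equation with the velocity
  u(r,theta) = 2 pi r^2 (sin theta, - cos theta):
  rho(t,r,theta) = rho0(r, theta + 2 pi t r).\<close>
definition sol :: "(complex \<Rightarrow> real) \<Rightarrow> real \<Rightarrow> complex \<Rightarrow> real" where
  "sol rho0 t z = rho0 (z * cis (2 * pi * t * cmod z))"

definition Linf_B1 :: "(complex \<Rightarrow> real) \<Rightarrow> real" where
  "Linf_B1 f = Inf {M. 0 \<le> M \<and> (AE x in lborel. x \<in> ball 0 1 \<longrightarrow> \<bar>f x\<bar> \<le> M)}"

definition mix_scale :: "real \<Rightarrow> (complex \<Rightarrow> real) \<Rightarrow> real" where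
  "mix_scale \<kappa> f = Inf {\<epsilon>. 0 < \<epsilon> \<and>
     (\<forall>x. \<bar>(LINT y:ball x \<epsilon>|lborel. indicator (cball 0 1) y * f y) / measure lborel (ball x \<epsilon>)\<bar>
            \<le> \<kappa> * Linf_B1 f)}"

definition Linf_supp_B1 :: "(complex \<Rightarrow> real) \<Rightarrow> bool" where
  "Linf_supp_B1 f \<longleftrightarrow> f \<in> borel_measurable borel \<and>
     (\<exists>M. AE x in lborel. \<bar>f x\<bar> \<le> M) \<and>
     (AE x in lborel. 1 < cmod x \<longrightarrow> f x = 0)"

definition test_fun_B1 :: "(complex \<Rightarrow> real) \<Rightarrow> bool" where
  "test_fun_B1 \<phi> \<longleftrightarrow> (\<forall>x. \<phi> differentiable at x) \<and>
     continuous_on UNIV (\<lambda>x. frechet_derivative \<phi> (at x) 1) \<and>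
     continuous_on UNIV (\<lambda>x. frechet_derivative \<phi> (at x) \<i>) \<and>
     (\<exists>K. compact K \<and> K \<subseteq> ball 0 1 \<and> (\<forall>x. x \<notin> K \<longrightarrow> \<phi> x = 0))"

definition weak_grad_B1 :: "(complex \<Rightarrow> real) \<Rightarrow> (complex \<Rightarrow> real) \<Rightarrow> (complex \<Rightarrow> real) \<Rightarrow> bool" where
  "weak_grad_B1 f g1 g2 \<longleftrightarrow>
     g1 \<in> borel_measurable lborel \<and> g2 \<in> borel_measurable lborel \<and>
     (\<forall>K. compact K \<and> K \<subseteq> ball 0 1 \<longrightarrow>
        set_integrable lborel K f \<and> set_integrable lborel K g1 \<and> set_integrable lborel K g2) \<and>
     (\<forall>\<phi>. test_fun_B1 \<phi> \<longrightarrow>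
        (LINT x:ball 0 1|lborel. f x * frechet_derivative \<phi> (at x) 1) = - (LINT x:ball 0 1|lborel. g1 x * \<phi> x) \<and>
        (LINT x:ball 0 1|lborel. f x * frechet_derivative \<phi> (at x) \<i>) = - (LINT x:ball 0 1|lborel. g2 x * \<phi> x))"

definition W_alpha_1_seminorm :: "real \<Rightarrow> (complex \<Rightarrow> real) \<Rightarrow> ennreal" where
  "W_alpha_1_seminorm \<alpha> f =
    (if \<alpha> < 1 then
       (\<integral>\<^sup>+ x. \<integral>\<^sup>+ y. indicator (ball 0 1) x * indicator (ball 0 1) y *
           ennreal (\<bar>f x - f y\<bar> / cmod (x - y) powr (2 + \<alpha>)) \<partial>lborel \<partial>lborel)
     else if (\<exists>g1 g2. weak_grad_B1 f g1 g2) then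
       (let (g1, g2) = (SOME (g1, g2). weak_grad_B1 f g1 g2) in
         \<integral>\<^sup>+ x. indicator (ball 0 1) x * ennreal (sqrt ((g1 x)\<^sup>2 + (g2 x)\<^sup>2)) \<partial>lborel)
     else \<infinity>)"

end

theory Submission
  imports Defs
begin

text \<open>Write \<open>T z = z e\<^bsup>2\<pi>it|z|\<^esup>\<close>, so that \<open>\<rho>(t) = \<rho>\<^sub>0 \<circ> T\<close>, and let \<open>I\<close> be the integral of
  \<open>\<rho>\<^sub>0 \<circ> T\<close> over a disk \<open>B\<close> of radius \<open>\<epsilon>\<close>. For \<open>0 \<le> s < 1/t\<close> the radial shift
  \<open>S\<^sub>s z = z + s z/|z|\<close> increases the angle of \<open>T\<close> by \<open>2\<pi>ts\<close>. Substituting \<open>S\<^sub>s\<close> in \<open>I\<close> therefore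
  shows that \<open>I\<close> differs from the integral of \<open>\<rho>\<^sub>0(T z e\<^bsup>2\<pi>its\<^esup>)\<close> over \<open>B\<close> by at most
  \<open>17\<pi> \<epsilon> s \<parallel>\<rho>\<^sub>0\<parallel>\<^sub>\<infinity>\<close> (Jacobian and boundary effects) plus the integral of
  \<open>|\<rho>\<^sub>0 \<circ> S\<^sub>s - \<rho>\<^sub>0|\<close> over a rotated and twisted copy of \<open>B\<close>. Averaging over \<open>s\<close> replaces the
  rotated integral by an integral of circle means of \<open>\<rho>\<^sub>0\<close>, which vanish. Relative to \<open>|B|\<close>
  the first error is of order \<open>1/(\<epsilon>t)\<close>. The second error is small by uniform continuity
  in case (i). In case (ii) it is of order \<open>t\<^bsup>-\<alpha>\<^esup>\<close>, because
  \<open>\<integral>|\<rho>\<^sub>0 \<circ> S\<^sub>s - \<rho>\<^sub>0|\<close> is controlled by the integral of \<open>|\<rho>\<^sub>0(y) - \<rho>\<^sub>0(z)|\<close> over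
  \<open>|y - z| < 2/t\<close>.\<close>

subsection \<open>Rotation invariance of planar Lebesgue measure\<close>

text \<open>The shift is radial because the angular speed depends on the radius alone: a
  displacement s < 1/t already realises every rotation of the density, and its price is a boundary
  layer of width s, hence an error of order \<epsilon> s rather than \<epsilon>^2. The Jacobian
  \<open>1 + s / cmod z\<close> is unbounded at 0 but integrable, and the image misses only the disk
  of radius s. A disk that reaches across the unit circle costs one more strip, since the density
  may jump to 0 there. The constant is 34 = 2 * 17: each error is allotted half of \<kappa> L |B|,
  and 17 = 1 + 2 + 4 + 10 counts the missed disk, the Jacobian, the boundary of B and the strip. In
  (ii) the second error is bounded over the whole unit disk and does not shrink with B, so it
  competes with |B|, of order \<epsilon>^2; this is the origin of the exponent \<alpha>/2. Polar
  coordinates are derived from rotation invariance and the law of |z|, so that twists with a merely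
  measurable angle are seen to preserve the measure without any differentiation.\<close>

lemma lborel_distr_translate:
  "distr lborel borel (\<lambda>x. x + c) = (lborel :: 'a::euclidean_space measure)"
proof -
  have "(\<lambda>x. x + c) = (+) c" by (auto simp: add.commute)
  then show ?thesis by (simp add: lborel_distr_plus)
qed

lemma nn_integral_lborel_translate:
  fixes f :: "'a::euclidean_space \<Rightarrow> ennreal"
  assumes [measurable]: "f \<in> borel_measurable borel"
  shows "(\<integral>\<^sup>+x. f (x + c) \<partial>lborel) = (\<integral>\<^sup>+x. f x \<partial>lborel)"
  by (subst lborel_distr_translate[of c, symmetric], subst nn_integral_distr) auto

lemma nn_integral_lborel_reflect:
  fixes f :: "'a::euclidean_space \<Rightarrow> ennreal"
  assumes [measurable]: "f \<in> borel_measurable borel"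
  shows "(\<integral>\<^sup>+x. f (c - x) \<partial>lborel) = (\<integral>\<^sup>+x. f x \<partial>lborel)"
proof -
  have "lborel = distr lborel borel (\<lambda>x::'a. c - x)"
    using lborel_affine[of "-1" c] by (simp add: density_1)
  then show ?thesis
    by (subst (2) \<open>lborel = distr lborel borel (\<lambda>x::'a. c - x)\<close>, subst nn_integral_distr) auto
qed

text \<open>Uniqueness of Haar measure, in the form needed here: evaluating the integral of
  \<open>1\<^sub>A(x) 1\<^sub>B(x + y)\<close> against \<open>M \<times> lborel\<close> in both orders gives
  \<open>M(A) |B| = M(B) |A|\<close>.\<close>
lemma translation_invariant_eq_lborel:
  fixes M :: "'a::euclidean_space measure"
  assumes sets_M [measurable_cong, simp]: "sets M = sets borel"
    and "sigma_finite_measure M"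
    and inv: "\<And>c. distr M borel (\<lambda>x. x + c) = M"
    and ball: "emeasure M (ball 0 1) = emeasure lborel (ball 0 1 :: 'a set)"
  shows "M = lborel"
proof (rule measure_eqI)
  interpret M: sigma_finite_measure M by fact
  interpret P: pair_sigma_finite M lborel ..
  fix A assume "A \<in> sets M"
  hence [measurable]: "A \<in> sets borel" by simp
  let ?B = "ball 0 1 :: 'a set"
  have [measurable]: "?B \<in> sets borel" by simp
  have "emeasure M A * emeasure lborel ?B =
      (\<integral>\<^sup>+x. indicator A x * (\<integral>\<^sup>+y. indicator ?B (y + x) \<partial>lborel) \<partial>M)"
    by (subst nn_integral_lborel_translate) (measurable, simp add: nn_integral_multc)
  also have "\<dots> = (\<integral>\<^sup>+x. (\<integral>\<^sup>+y. indicator A x * indicator ?B (y + x) \<partial>lborel) \<partial>M)"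
    by (intro nn_integral_cong nn_integral_cmult[symmetric]) measurable
  also have "\<dots> = (\<integral>\<^sup>+y. (\<integral>\<^sup>+x. indicator A x * indicator ?B (y + x) \<partial>M) \<partial>lborel)"
    by (rule P.Fubini'[symmetric]) measurable
  also have "\<dots> = (\<integral>\<^sup>+y. (\<integral>\<^sup>+x. indicator A (x - y) * indicator ?B x \<partial>M) \<partial>lborel)"
  proof (rule nn_integral_cong)
    fix y :: 'a
    have "(\<integral>\<^sup>+x. indicator A (x - y) * indicator ?B x \<partial>distr M borel (\<lambda>x. x + y)) =
       (\<integral>\<^sup>+x. indicator A x * indicator ?B (y + x) \<partial>M)"
      by (subst nn_integral_distr) (auto simp: add.commute)
    then show "(\<integral>\<^sup>+x. indicator A x * indicator ?B (y + x) \<partial>M) =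
        (\<integral>\<^sup>+x. indicator A (x - y) * indicator ?B x \<partial>M)"
      using inv[of y] by simp
  qed
  also have "\<dots> = (\<integral>\<^sup>+x. (\<integral>\<^sup>+y. indicator A (x - y) * indicator ?B x \<partial>lborel) \<partial>M)"
    by (rule P.Fubini') measurable
  also have "\<dots> = (\<integral>\<^sup>+x. (\<integral>\<^sup>+y. indicator A (x - y) \<partial>lborel) * indicator ?B x \<partial>M)"
    by (intro nn_integral_cong nn_integral_multc) measurable
  also have "\<dots> = emeasure lborel A * emeasure lborel ?B"
    by (simp add: nn_integral_lborel_reflect nn_integral_cmult ball)
  finally have "emeasure lborel ?B * emeasure M A = emeasure lborel ?B * emeasure lborel A"
    by (simp add: mult.commute)
  moreover have "emeasure lborel ?B \<noteq> 0" "emeasure lborel ?B \<noteq> \<infinity>"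
    using unit_ball_vol_pos[of "real DIM('a)"] by (auto simp: emeasure_ball simp del: unit_ball_vol_pos)
  ultimately show "emeasure M A = emeasure lborel A"
    by (simp add: ennreal_mult_cancel_left)
qed simp

text \<open>Translating by c after the rotation equals translating by \<open>c * cnj a\<close>
  before it, so the rotated measure is again translation invariant; balls about 0 are mapped to
  themselves, which fixes the normalisation.\<close>

lemma lborel_distr_rotate:
  assumes a: "cmod a = 1"
  shows "distr lborel borel (\<lambda>z. z * a) = (lborel :: complex measure)"
proof (rule translation_invariant_eq_lborel)
  let ?M = "distr lborel borel (\<lambda>z. z * a)"
  have a': "cnj a * a = 1"
    using a by (metis complex_norm_square mult.commute of_real_1 power_one)
  have ball: "(\<lambda>z. z * a) -` ball 0 r = ball 0 r" for r
    using a by (auto simp: norm_mult)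
  then have em: "emeasure ?M (ball 0 r) = emeasure lborel (ball 0 r :: complex set)" for r
    by (subst emeasure_distr) auto
  show "sigma_finite_measure ?M"
  proof
    let ?A = "range (\<lambda>n::nat. ball 0 (real n)) :: complex set set"
    have "\<Union>?A = UNIV"
      using reals_Archimedean2 by auto
    moreover have "\<forall>a\<in>?A. emeasure ?M a \<noteq> \<infinity>"
      by (auto simp: em emeasure_ball)
    ultimately show "\<exists>A. countable A \<and> A \<subseteq> sets ?M \<and> \<Union>A = space ?M \<and> (\<forall>a\<in>A. emeasure ?M a \<noteq> \<infinity>)"
      by (intro exI[of _ ?A]) auto
  qed
  show "emeasure ?M (ball 0 1) = emeasure lborel (ball 0 1 :: complex set)"
    by (rule em)
  fix c :: complex
  have "distr ?M borel (\<lambda>x. x + c) = distr lborel borel ((\<lambda>x. x + c) \<circ> (\<lambda>z. z * a))"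
    by (rule distr_distr) auto
  also have "(\<lambda>x. x + c) \<circ> (\<lambda>z. z * a) = (\<lambda>z. z * a) \<circ> (\<lambda>x. x + c * cnj a)"
    using a' by (auto simp: algebra_simps)
  also have "distr lborel borel \<dots> = distr (distr lborel borel (\<lambda>x. x + c * cnj a)) borel (\<lambda>z. z * a)"
    by (rule distr_distr[symmetric]) auto
  also have "\<dots> = ?M" by (simp add: lborel_distr_translate)
  finally show "distr ?M borel (\<lambda>x. x + c) = ?M" .
qed simp

subsection \<open>Polar coordinates\<close>

text \<open>The disk of radius a has area pi a^2, whose derivative is the density. Half-lines
  generate the Borel sets and are stable under intersection, so comparing these areas
  suffices.\<close>

lemma distr_cmod_lborel:
  "distr lborel borel cmod = density lborel (\<lambda>r. ennreal (2 * pi * r) * indicator {0..} r)"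
proof (rule measure_eqI_generator_eq[where E = "range atMost" and A = "\<lambda>n::nat. {..real n}" and \<Omega> = UNIV])
  show "Int_stable (range atMost :: real set set)"
    by (auto simp: Int_stable_def)
  have E: "emeasure (distr lborel borel cmod) {..a} = ennreal (if 0 \<le> a then pi * a\<^sup>2 else 0)" for a
  proof -
    have "cmod -` {..a} = cball 0 a" by auto
    then show ?thesis
      by (cases "0 \<le> a") (auto simp: emeasure_distr emeasure_cball unit_ball_vol_2)
  qed
  fix X :: "real set" assume "X \<in> range atMost"
  then obtain a where X: "X = {..a}" by auto
  have "emeasure (density lborel (\<lambda>r. ennreal (2 * pi * r) * indicator {0..} r)) {..a} =
     (\<integral>\<^sup>+r. ennreal (2 * pi * r) * indicator {0..a} r \<partial>lborel)"
    by (subst emeasure_density) (auto intro!: nn_integral_cong split: split_indicator)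
  also have "\<dots> = ennreal (if 0 \<le> a then pi * a\<^sup>2 else 0)"
  proof (cases "0 \<le> a")
    case True
    have "(\<integral>\<^sup>+r. ennreal (2 * pi * r) * indicator {0..a} r \<partial>lborel) = ennreal (pi * a\<^sup>2 - pi * 0\<^sup>2)"
      using True by (intro nn_integral_FTC_Icc) (auto intro!: derivative_eq_intros)
    with True show ?thesis by simp
  qed auto
  finally show "emeasure (distr lborel borel cmod) X =
      emeasure (density lborel (\<lambda>r. ennreal (2 * pi * r) * indicator {0..} r)) X"
    by (simp add: X E)
next
  fix n :: nat
  have "cmod -` {..real n} = cball 0 (real n)" by auto
  then show "emeasure (distr lborel borel cmod) {..real n} \<noteq> \<infinity>"
    by (auto simp: emeasure_distr emeasure_cball)
next
  show "(\<Union>n. {..real n}) = UNIV"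
    using real_arch_simple by auto
qed (auto simp: borel_eq_atMost)

lemma nn_integral_cmod:
  assumes [measurable]: "f \<in> borel_measurable borel"
  shows "(\<integral>\<^sup>+z. f (cmod z) \<partial>lborel) = (\<integral>\<^sup>+r. ennreal (2 * pi * r) * indicator {0..} r * f r \<partial>lborel)"
proof -
  have "(\<integral>\<^sup>+z. f (cmod z) \<partial>lborel) = (\<integral>\<^sup>+r. f r \<partial>distr lborel borel cmod)"
    by (subst nn_integral_distr) auto
  then show ?thesis
    by (simp add: distr_cmod_lborel nn_integral_density)
qed

text \<open>Arc length on the unit circle, unnormalised (mass 2 pi) and carried by the whole plane
  so that rotations act by multiplication. The half-open interval counts every point of the circle
  once.\<close>

definition circle_measure :: "complex measure" where
  "circle_measure = distr (density lborel (indicator {0..<2*pi})) borel cis"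

lemma borel_measurable_cis [measurable]: "cis \<in> borel_measurable borel"
  by (intro borel_measurable_continuous_onI continuous_intros)

lemma sets_circle_measure [simp, measurable_cong]: "sets circle_measure = sets borel"
  by (simp add: circle_measure_def)

lemma space_circle_measure [simp]: "space circle_measure = UNIV"
  by (simp add: circle_measure_def)

lemma nn_integral_circle_measure:
  assumes [measurable]: "f \<in> borel_measurable borel"
  shows "(\<integral>\<^sup>+u. f u \<partial>circle_measure) = (\<integral>\<^sup>+\<theta>. indicator {0..<2*pi} \<theta> * f (cis \<theta>) \<partial>lborel)"
  by (simp add: circle_measure_def nn_integral_distr nn_integral_density)

lemma emeasure_circle_measure_UNIV: "emeasure circle_measure UNIV = ennreal (2 * pi)"
  by (simp add: circle_measure_def emeasure_distr emeasure_density)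

interpretation circle_measure: finite_measure circle_measure
  by standard (simp add: emeasure_circle_measure_UNIV)

interpretation circle_pair: pair_sigma_finite "lborel :: 'a::euclidean_space measure" circle_measure ..

lemma AE_circle_measure:
  assumes "\<And>\<theta>. 0 \<le> \<theta> \<Longrightarrow> \<theta> < 2 * pi \<Longrightarrow> P (cis \<theta>)" and [measurable]: "Measurable.pred borel P"
  shows "AE u in circle_measure. P u"
proof -
  have "AE \<theta> in density lborel (indicator {0..<2*pi}). P (cis \<theta>)"
    by (subst AE_density) (use assms(1) in \<open>auto simp: indicator_def\<close>)
  then show ?thesis
    unfolding circle_measure_def by (subst AE_distr_iff) auto
qed

text \<open>A rotation moves the angle window from [0, 2 pi) to [b, b + 2 pi); the part beyond 2 pi
  is moved back by one period of \<open>cis\<close>.\<close>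

lemma distr_circle_measure_rotate:
  assumes "cmod a = 1"
  shows "distr circle_measure borel (\<lambda>u. a * u) = circle_measure"
proof (rule measure_eqI)
  fix A assume "A \<in> sets (distr circle_measure borel (\<lambda>u. a * u))"
  hence [measurable]: "A \<in> sets borel" by simp
  obtain b where b: "0 \<le> b" "b < 2 * pi" "a = cis b"
    using Arg2pi[of a] assms by (intro that[of "Arg2pi a"]) (auto simp: is_Arg_def cis_conv_exp)
  define F where "F = (\<lambda>\<theta>. indicator A (cis \<theta>) :: ennreal)"
  have F [measurable]: "F \<in> borel_measurable borel" by (simp add: F_def)
  have "emeasure (distr circle_measure borel (\<lambda>u. a * u)) A =
      (\<integral>\<^sup>+u. indicator A u \<partial>distr circle_measure borel (\<lambda>u. a * u))"
    by simp
  also have "\<dots> = (\<integral>\<^sup>+u. indicator A (a * u) \<partial>circle_measure)"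
    by (subst nn_integral_distr) auto
  also have "\<dots> = (\<integral>\<^sup>+\<theta>. indicator {b..<b+2*pi} (\<theta> + b) * F (\<theta> + b) \<partial>lborel)"
    by (subst nn_integral_circle_measure)
       (auto simp: F_def b(3) cis_mult add_ac intro!: nn_integral_cong split: split_indicator)
  also have "\<dots> = (\<integral>\<^sup>+\<theta>. indicator {b..<b+2*pi} \<theta> * F \<theta> \<partial>lborel)"
    by (rule nn_integral_lborel_translate) auto
  also have "\<dots> = (\<integral>\<^sup>+\<theta>. indicator {b..<2*pi} \<theta> * F \<theta> + indicator {2*pi..<b+2*pi} \<theta> * F \<theta> \<partial>lborel)"
    using b by (intro nn_integral_cong) (auto split: split_indicator)
  also have "\<dots> = (\<integral>\<^sup>+\<theta>. indicator {b..<2*pi} \<theta> * F \<theta> \<partial>lborel) +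
      (\<integral>\<^sup>+\<theta>. indicator {2*pi..<b+2*pi} \<theta> * F \<theta> \<partial>lborel)"
    by (rule nn_integral_add) auto
  also have "(\<integral>\<^sup>+\<theta>. indicator {2*pi..<b+2*pi} \<theta> * F \<theta> \<partial>lborel) =
      (\<integral>\<^sup>+\<theta>. indicator {2*pi..<b+2*pi} (\<theta> + 2 * pi) * F (\<theta> + 2 * pi) \<partial>lborel)"
    by (rule nn_integral_lborel_translate[symmetric]) auto
  also have "\<dots> = (\<integral>\<^sup>+\<theta>. indicator {0..<b} \<theta> * F \<theta> \<partial>lborel)"
    by (intro nn_integral_cong) (auto simp: F_def cis_mult[symmetric] split: split_indicator)
  also have "(\<integral>\<^sup>+\<theta>. indicator {b..<2*pi} \<theta> * F \<theta> \<partial>lborel) + \<dots> =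
      (\<integral>\<^sup>+\<theta>. indicator {b..<2*pi} \<theta> * F \<theta> + indicator {0..<b} \<theta> * F \<theta> \<partial>lborel)"
    by (rule nn_integral_add[symmetric]) auto
  also have "\<dots> = (\<integral>\<^sup>+\<theta>. indicator {0..<2*pi} \<theta> * F \<theta> \<partial>lborel)"
    using b by (intro nn_integral_cong) (auto split: split_indicator)
  also have "\<dots> = (\<integral>\<^sup>+u. indicator A u \<partial>circle_measure)"
    by (subst nn_integral_circle_measure) (auto simp: F_def)
  finally show "emeasure (distr circle_measure borel (\<lambda>u. a * u)) A = emeasure circle_measure A"
    by simp
qed simp

lemma nn_integral_circle_measure_rotate:
  assumes [measurable]: "f \<in> borel_measurable borel" and "cmod a = 1"
  shows "(\<integral>\<^sup>+u. f (a * u) \<partial>circle_measure) = (\<integral>\<^sup>+u. f u \<partial>circle_measure)"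
proof -
  have "(\<integral>\<^sup>+u. f u \<partial>distr circle_measure borel (\<lambda>u. a * u)) = (\<integral>\<^sup>+u. f (a * u) \<partial>circle_measure)"
    by (subst nn_integral_distr) auto
  then show ?thesis
    by (simp add: distr_circle_measure_rotate assms)
qed

lemma integral_circle_measure_rotate:
  fixes f :: "complex \<Rightarrow> real"
  assumes [measurable]: "f \<in> borel_measurable borel" and "cmod a = 1"
  shows "(\<integral>u. f (a * u) \<partial>circle_measure) = (\<integral>u. f u \<partial>circle_measure)"
proof -
  have "(\<integral>u. f u \<partial>distr circle_measure borel (\<lambda>u. a * u)) = (\<integral>u. f (a * u) \<partial>circle_measure)"
    by (subst integral_distr) auto
  then show ?thesis
    by (simp add: distr_circle_measure_rotate assms)
qed

text \<open>The planar integral is averaged over all rotations. After exchanging the integrals, the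
  inner circle integral depends on |z| only, so the law of |z| applies; the mass 2 pi of the circle
  cancels the factor in the radial density.\<close>

lemma nn_integral_polar:
  fixes f :: "complex \<Rightarrow> ennreal"
  assumes f [measurable]: "f \<in> borel_measurable borel"
  shows "(\<integral>\<^sup>+z. f z \<partial>lborel) =
    (\<integral>\<^sup>+r. indicator {0<..} r * ennreal r * (\<integral>\<^sup>+u. f (of_real r * u) \<partial>circle_measure) \<partial>lborel)"
proof -
  define G where "G = (\<lambda>r::real. \<integral>\<^sup>+u. f (of_real r * u) \<partial>circle_measure)"
  have [measurable]: "G \<in> borel_measurable borel"
    unfolding G_def by measurable
  have G: "(\<integral>\<^sup>+u. f (z * u) \<partial>circle_measure) = G (cmod z)" for z
  proof (cases "z = 0")
    case False
    have "(\<integral>\<^sup>+u. f (of_real (cmod z) * (sgn z * u)) \<partial>circle_measure) = G (cmod z)"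
      unfolding G_def using False
      by (intro nn_integral_circle_measure_rotate[where f="\<lambda>u. f (of_real (cmod z) * u)"])
         (auto simp: norm_sgn)
    moreover have "of_real (cmod z) * (sgn z * u) = z * u" for u
      using False by (simp add: sgn_eq)
    ultimately show ?thesis by simp
  qed (simp add: G_def)
  have "ennreal (2 * pi) * (\<integral>\<^sup>+z. f z \<partial>lborel) = (\<integral>\<^sup>+u. (\<integral>\<^sup>+z. f z \<partial>lborel) \<partial>circle_measure)"
    by (simp add: emeasure_circle_measure_UNIV mult.commute)
  also have "\<dots> = (\<integral>\<^sup>+u. (\<integral>\<^sup>+z. f (z * u) \<partial>lborel) \<partial>circle_measure)"
  proof (rule nn_integral_cong_AE, rule AE_circle_measure)
    fix \<theta> :: real
    have "(\<integral>\<^sup>+z. f z \<partial>distr lborel borel (\<lambda>z. z * cis \<theta>)) = (\<integral>\<^sup>+z. f (z * cis \<theta>) \<partial>lborel)"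
      by (subst nn_integral_distr) auto
    then show "(\<integral>\<^sup>+z. f z \<partial>lborel) = (\<integral>\<^sup>+z. f (z * cis \<theta>) \<partial>lborel)"
      by (simp add: lborel_distr_rotate)
  qed measurable
  also have "\<dots> = (\<integral>\<^sup>+z. (\<integral>\<^sup>+u. f (z * u) \<partial>circle_measure) \<partial>lborel)"
    by (rule circle_pair.Fubini') measurable
  also have "\<dots> = (\<integral>\<^sup>+z. G (cmod z) \<partial>lborel)"
    by (simp add: G)
  also have "\<dots> = (\<integral>\<^sup>+r. ennreal (2 * pi * r) * indicator {0..} r * G r \<partial>lborel)"
    by (rule nn_integral_cmod) auto
  also have "\<dots> = (\<integral>\<^sup>+r. ennreal (2 * pi) * (indicator {0<..} r * ennreal r * G r) \<partial>lborel)"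
    by (intro nn_integral_cong) (auto simp: ennreal_mult' mult_ac split: split_indicator)
  also have "\<dots> = ennreal (2 * pi) * (\<integral>\<^sup>+r. indicator {0<..} r * ennreal r * G r \<partial>lborel)"
    by (rule nn_integral_cmult) auto
  finally show ?thesis
    by (subst (asm) ennreal_mult_cancel_left) (auto simp: G_def)
qed

text \<open>On each circle about 0 the map is a rotation by a fixed angle, which preserves arc
  length, and the radius is untouched. The flow is the case of the angle 2 pi t r.\<close>

lemma lborel_distr_twist:
  assumes [measurable]: "a \<in> borel_measurable borel"
  shows "distr lborel borel (\<lambda>z. z * cis (a (cmod z))) = (lborel :: complex measure)"
proof (rule measure_eqI)
  let ?T = "\<lambda>z. z * cis (a (cmod z))"
  fix A assume "A \<in> sets (distr lborel borel ?T)"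
  hence [measurable]: "A \<in> sets borel" by simp
  have "emeasure (distr lborel borel ?T) A = (\<integral>\<^sup>+z. indicator A z \<partial>distr lborel borel ?T)"
    by simp
  also have "\<dots> = (\<integral>\<^sup>+z. indicator A (?T z) \<partial>lborel)"
    by (subst nn_integral_distr) auto
  also have "\<dots> = (\<integral>\<^sup>+r. indicator {0<..} r * ennreal r *
      (\<integral>\<^sup>+u. indicator A (of_real r * u * cis (a (cmod (of_real r * u)))) \<partial>circle_measure) \<partial>lborel)"
    by (subst nn_integral_polar) auto
  also have "\<dots> = (\<integral>\<^sup>+r. indicator {0<..} r * ennreal r *
      (\<integral>\<^sup>+u. indicator A (of_real r * u) \<partial>circle_measure) \<partial>lborel)"
  proof (intro nn_integral_cong)
    fix r :: real
    have "(\<integral>\<^sup>+u. indicator A (of_real r * u * cis (a (cmod (of_real r * u)))) \<partial>circle_measure) =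
        (\<integral>\<^sup>+u. indicator A (of_real r * (cis (a r) * u)) \<partial>circle_measure)" if "r > 0"
      using that
      by (intro nn_integral_cong_AE AE_circle_measure) (auto simp: norm_mult mult_ac)
    also have "(\<integral>\<^sup>+u. indicator A (of_real r * (cis (a r) * u)) \<partial>circle_measure) =
        (\<integral>\<^sup>+u. indicator A (of_real r * u) \<partial>circle_measure)"
      by (rule nn_integral_circle_measure_rotate[where f="\<lambda>u. indicator A (of_real r * u)"]) auto
    finally show "indicator {0<..} r * ennreal r *
         (\<integral>\<^sup>+u. indicator A (of_real r * u * cis (a (cmod (of_real r * u)))) \<partial>circle_measure) =
        indicator {0<..} r * ennreal r * (\<integral>\<^sup>+u. indicator A (of_real r * u) \<partial>circle_measure)"
      by (auto split: split_indicator)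
  qed
  also have "\<dots> = (\<integral>\<^sup>+z. indicator A z \<partial>lborel)"
    by (subst nn_integral_polar) auto
  finally show "emeasure (distr lborel borel ?T) A = emeasure lborel A"
    by simp
qed simp

section \<open>The radial shift and its Jacobian\<close>

definition radial_shift :: "real \<Rightarrow> complex \<Rightarrow> complex" where
  "radial_shift s z = z + of_real s * sgn z"

lemma borel_measurable_radial_shift [measurable]: "radial_shift s \<in> borel_measurable borel"
  unfolding radial_shift_def sgn_eq by measurable

text \<open>The origin is excluded because \<open>sgn 0 = 0\<close> keeps it fixed; it is a null
  set.\<close>

lemma cmod_radial_shift: "z \<noteq> 0 \<Longrightarrow> 0 \<le> s \<Longrightarrow> cmod (radial_shift s z) = cmod z + s"
proof -
  assume z: "z \<noteq> 0" "0 \<le> s"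
  have "radial_shift s z = of_real (cmod z + s) * sgn z"
    using z by (simp add: radial_shift_def sgn_eq algebra_simps)
  then show ?thesis
    using z by (simp add: norm_mult norm_sgn del: of_real_add)
qed

lemma dist_radial_shift: "0 \<le> s \<Longrightarrow> dist (radial_shift s z) z \<le> s"
  by (simp add: radial_shift_def dist_norm norm_mult norm_sgn)

text \<open>Commuting with rotations is what lets the shift pass through the twist.\<close>

lemma radial_shift_mult: "cmod a = 1 \<Longrightarrow> radial_shift s (z * a) = radial_shift s z * a"
  by (simp add: radial_shift_def sgn_eq norm_mult algebra_simps add_divide_distrib)

text \<open>In polar coordinates the shift replaces r by r + s and keeps the direction, and r (1 +
  s/r) = r + s turns the area weight at r into the one at r + s. The radii reached are those above
  s, hence the restriction on the right.\<close>

lemma nn_integral_radial_shift: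
  fixes f :: "complex \<Rightarrow> ennreal"
  assumes [measurable]: "f \<in> borel_measurable borel" and s: "0 \<le> s"
  shows "(\<integral>\<^sup>+z. f (radial_shift s z) * ennreal (1 + s / cmod z) \<partial>lborel) =
    (\<integral>\<^sup>+z. indicator {z. s < cmod z} z * f z \<partial>lborel)"
proof -
  define G where "G = (\<lambda>r::real. \<integral>\<^sup>+u. f (of_real r * u) \<partial>circle_measure)"
  have [measurable]: "G \<in> borel_measurable borel"
    unfolding G_def by measurable
  have "(\<integral>\<^sup>+z. f (radial_shift s z) * ennreal (1 + s / cmod z) \<partial>lborel) =
    (\<integral>\<^sup>+r. indicator {0<..} r * ennreal r * (\<integral>\<^sup>+u. f (radial_shift s (of_real r * u)) *
       ennreal (1 + s / cmod (of_real r * u)) \<partial>circle_measure) \<partial>lborel)"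
    by (rule nn_integral_polar) measurable
  also have "\<dots> = (\<integral>\<^sup>+r. indicator {s<..} (r + s) * ennreal (r + s) * G (r + s) \<partial>lborel)"
  proof (rule nn_integral_cong)
    fix r :: real
    have "ennreal r * (\<integral>\<^sup>+u. f (radial_shift s (of_real r * u)) *
       ennreal (1 + s / cmod (of_real r * u)) \<partial>circle_measure) = ennreal (r + s) * G (r + s)" if r: "r > 0"
    proof -
      have "(\<integral>\<^sup>+u. f (radial_shift s (of_real r * u)) *
         ennreal (1 + s / cmod (of_real r * u)) \<partial>circle_measure) =
        (\<integral>\<^sup>+u. f (of_real (r + s) * u) * ennreal (1 + s / r) \<partial>circle_measure)"
      proof (intro nn_integral_cong_AE AE_circle_measure)
        fix \<theta> :: real
        have "radial_shift s (of_real r * cis \<theta>) = of_real (r + s) * cis \<theta>"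
          using r by (simp add: radial_shift_def sgn_eq norm_mult algebra_simps)
        then show "f (radial_shift s (of_real r * cis \<theta>)) * ennreal (1 + s / cmod (of_real r * cis \<theta>)) =
            f (of_real (r + s) * cis \<theta>) * ennreal (1 + s / r)"
          using r by (simp add: norm_mult)
      qed measurable
      also have "\<dots> = G (r + s) * ennreal (1 + s / r)"
        unfolding G_def by (rule nn_integral_multc) measurable
      also have "ennreal r * \<dots> = ennreal (r * (1 + s / r)) * G (r + s)"
        using r s by (subst ennreal_mult) (auto simp: mult_ac)
      also have "r * (1 + s / r) = r + s"
        using r by (simp add: field_simps)
      finally show ?thesis .
    qed
    then show "indicator {0<..} r * ennreal r * (\<integral>\<^sup>+u. f (radial_shift s (of_real r * u)) *
       ennreal (1 + s / cmod (of_real r * u)) \<partial>circle_measure) =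
       indicator {s<..} (r + s) * ennreal (r + s) * G (r + s)"
      by (auto split: split_indicator)
  qed
  also have "\<dots> = (\<integral>\<^sup>+r. indicator {s<..} r * ennreal r * G r \<partial>lborel)"
    by (rule nn_integral_lborel_translate[where f = "\<lambda>r. indicator {s<..} r * ennreal r * G r"]) measurable
  also have "\<dots> = (\<integral>\<^sup>+r. indicator {0<..} r * ennreal r * (\<integral>\<^sup>+u. indicator {z. s < cmod z} (of_real r * u) *
       f (of_real r * u) \<partial>circle_measure) \<partial>lborel)"
  proof (rule nn_integral_cong)
    fix r :: real
    have "(\<integral>\<^sup>+u. indicator {z. s < cmod z} (of_real r * u) * f (of_real r * u) \<partial>circle_measure) =
      (\<integral>\<^sup>+u. indicator {s<..} r * f (of_real r * u) \<partial>circle_measure)" if "r > 0"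
      using that
      by (intro nn_integral_cong_AE AE_circle_measure) (auto simp: norm_mult split: split_indicator)
    also have "\<dots> = indicator {s<..} r * G r"
      unfolding G_def by (rule nn_integral_cmult) measurable
    finally show "indicator {s<..} r * ennreal r * G r = indicator {0<..} r * ennreal r *
        (\<integral>\<^sup>+u. indicator {z. s < cmod z} (of_real r * u) * f (of_real r * u) \<partial>circle_measure)"
      using s by (auto split: split_indicator)
  qed
  also have "\<dots> = (\<integral>\<^sup>+z. indicator {z. s < cmod z} z * f z \<partial>lborel)"
    by (rule nn_integral_polar[symmetric]) measurable
  finally show ?thesis .
qed

section \<open>Null sets of radii and null sets of the plane\<close>

lemma AE_cmod:
  assumes "AE r in lborel. 0 < r \<longrightarrow> P r"
  shows "AE z in lborel. 0 < cmod z \<longrightarrow> P (cmod z)"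
proof -
  have "AE r in distr lborel borel cmod. 0 < r \<longrightarrow> P r"
    unfolding distr_cmod_lborel using assms by (subst AE_density) auto
  then show ?thesis
    by (rule AE_distrD[rotated]) auto
qed

lemma AE_lborel_twist:
  assumes "AE z in lborel. P z" and [measurable]: "a \<in> borel_measurable borel"
  shows "AE z in lborel. P (z * cis (a (cmod z)))"
proof -
  have "AE z in distr lborel borel (\<lambda>z. z * cis (a (cmod z))). P z"
    unfolding lborel_distr_twist[OF assms(2)] by (rule assms(1))
  then show ?thesis
    by (rule AE_distrD[rotated]) measurable
qed

text \<open>Circle integrals based at z or at its modulus agree by rotation invariance. This turns a
  statement about almost every radius into one about almost every point, ready to be composed with a
  twist.\<close>

lemma AE_circle_mean_zero:
  fixes h :: "complex \<Rightarrow> real"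
  assumes [measurable]: "h \<in> borel_measurable borel"
    and mean: "AE r in lborel. 0 < r \<longrightarrow> (\<integral>u. h (of_real r * u) \<partial>circle_measure) = 0"
  shows "AE z in lborel. (\<integral>u. h (z * u) \<partial>circle_measure) = 0"
proof -
  have "AE z in lborel. z \<noteq> (0::complex)"
    by (rule AE_lborel_singleton)
  with AE_cmod[OF mean] show ?thesis
  proof eventually_elim
    case (elim z)
    have "(\<integral>u. h (of_real (cmod z) * (sgn z * u)) \<partial>circle_measure) =
        (\<integral>u. h (of_real (cmod z) * u) \<partial>circle_measure)"
      using elim by (intro integral_circle_measure_rotate[where f="\<lambda>u. h (of_real (cmod z) * u)"])
         (auto simp: norm_sgn)
    moreover have "of_real (cmod z) * (sgn z * u) = z * u" for u
      using elim by (simp add: sgn_eq)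
    ultimately show ?case using elim by simp
  qed
qed

subsection \<open>The averaging estimate\<close>

lemma measure_ball_complex: "0 \<le> r \<Longrightarrow> measure lborel (ball (x::complex) r) = pi * r\<^sup>2"
  by (simp add: content_ball unit_ball_vol_2)

lemma fmeasurable_ball_lborel [simp]: "ball (x::'a::euclidean_space) r \<in> fmeasurable lborel"
  using emeasure_bounded_finite[OF bounded_ball] by (intro fmeasurableI) auto

lemma integrable_indicator_ball [simp]:
  "integrable lborel (indicator (ball (x::'a::euclidean_space) r) :: 'a \<Rightarrow> real)"
  using emeasure_bounded_finite[OF bounded_ball] by (intro integrable_real_indicator) auto

lemma integrable_bounded_on_ball:
  fixes f :: "'a::euclidean_space \<Rightarrow> real"
  assumes "f \<in> borel_measurable borel" and "\<And>z. \<bar>f z\<bar> \<le> M * indicator (ball x r) z"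
  shows "integrable lborel f"
  by (rule Bochner_Integration.integrable_bound[where f = "\<lambda>z. M * indicator (ball x r) z"])
     (use assms order_trans[OF assms(2) abs_ge_self] in auto)

text \<open>Both claims follow from one identity of measures: the image of (1 + s/|z|) dz under the
  shift is Lebesgue measure on |z| > s. It transfers the formula for nonnegative functions to signed
  ones.\<close>

lemma
  fixes f :: "complex \<Rightarrow> real"
  assumes f: "integrable lborel f" and s: "0 \<le> s"
  shows integrable_radial_shift: "integrable lborel (\<lambda>z. (1 + s / cmod z) * f (radial_shift s z))"
    and integral_radial_shift: "(\<integral>z. (1 + s / cmod z) * f (radial_shift s z) \<partial>lborel) =
      (\<integral>z. indicator {z. s < cmod z} z * f z \<partial>lborel)"
proof -
  have [measurable]: "f \<in> borel_measurable borel"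
    using f by simp
  have eq: "distr (density lborel (\<lambda>z. ennreal (1 + s / cmod z))) borel (radial_shift s) =
      density lborel (\<lambda>z. ennreal (indicator {z. s < cmod z} z))"
  proof (rule measure_eqI)
    let ?D = "distr (density lborel (\<lambda>z. ennreal (1 + s / cmod z))) borel (radial_shift s)"
    fix A assume "A \<in> sets ?D"
    hence [measurable]: "A \<in> sets borel" by simp
    have "emeasure ?D A = (\<integral>\<^sup>+z. indicator A z \<partial>?D)"
      by simp
    also have "\<dots> = (\<integral>\<^sup>+z. indicator A (radial_shift s z) * ennreal (1 + s / cmod z) \<partial>lborel)"
      by (subst nn_integral_distr, simp, simp)
         (subst nn_integral_density, auto simp: mult.commute)
    also have "\<dots> = (\<integral>\<^sup>+z. indicator {z. s < cmod z} z * indicator A z \<partial>lborel)"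
      by (rule nn_integral_radial_shift) (use s in auto)
    also have "\<dots> = emeasure (density lborel (\<lambda>z. ennreal (indicator {z. s < cmod z} z))) A"
      by (subst emeasure_density) (auto simp: ennreal_indicator)
    finally show "emeasure ?D A = emeasure (density lborel (\<lambda>z. ennreal (indicator {z. s < cmod z} z))) A" .
  qed simp
  have "integrable lborel (\<lambda>z. indicator {z. s < cmod z} z * f z)"
    by (rule Bochner_Integration.integrable_bound[OF f]) (auto split: split_indicator)
  then have "integrable (density lborel (\<lambda>z. ennreal (indicator {z. s < cmod z} z))) f"
    by (subst integrable_density) auto
  then have "integrable (density lborel (\<lambda>z. ennreal (1 + s / cmod z))) (\<lambda>z. f (radial_shift s z))"
    unfolding eq[symmetric] by (subst (asm) integrable_distr_eq) auto
  then show "integrable lborel (\<lambda>z. (1 + s / cmod z) * f (radial_shift s z))"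
    using s by (subst (asm) integrable_density) auto
  have "(\<integral>z. f z \<partial>density lborel (\<lambda>z. ennreal (indicator {z. s < cmod z} z))) =
      (\<integral>z. indicator {z. s < cmod z} z * f z \<partial>lborel)"
    by (subst integral_density) auto
  moreover have "(\<integral>z. f z \<partial>distr (density lborel (\<lambda>z. ennreal (1 + s / cmod z))) borel (radial_shift s)) =
      (\<integral>z. (1 + s / cmod z) * f (radial_shift s z) \<partial>lborel)"
    using s by (subst integral_distr, simp, simp) (subst integral_density, auto)
  ultimately show "(\<integral>z. (1 + s / cmod z) * f (radial_shift s z) \<partial>lborel) =
      (\<integral>z. indicator {z. s < cmod z} z * f z \<partial>lborel)"
    by (simp add: eq)
qed

text \<open>The full strip has area of order s, which would lose the factor \<epsilon>; a dilation
  yields it uniformly in x. With c = 1 - s and A = B \<inter> B_1, the dilate c A lies in B_c and in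
  the disk about x of radius \<epsilon> + s |x|, so c^2 |A| is at most |B \<inter> B_c| plus the
  area of an annulus. The strip is A minus B \<inter> B_c.\<close>

lemma measure_ball_strip_le:
  assumes "0 \<le> s" "s \<le> \<epsilon>" "\<epsilon> \<le> 1"
  shows "measure lborel (ball x \<epsilon> \<inter> {z. 1 - s \<le> cmod z \<and> cmod z < 1}) \<le> 10 * pi * \<epsilon> * s"
    (is "measure lborel ?S \<le> _")
proof -
  have fin: "A \<in> fmeasurable lborel" if "A \<subseteq> ball x r" "A \<in> sets borel" for A :: "complex set" and x r
    using that by (intro fmeasurableI2[OF fmeasurable_ball_lborel]) auto
  \<comment> \<open>For s = 1 the dilation degenerates, but |B| itself is below the bound; for |x|
    \<ge> 1 + \<epsilon> the strip is empty. The last case provides |x| \<le> 2.\<close>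
  consider "s = 1" | "cmod x \<ge> 1 + \<epsilon>" | "s < 1" "cmod x < 1 + \<epsilon>"
    using assms by linarith
  then show ?thesis
  proof cases
    case 1
    then have "\<epsilon> = 1" using assms by simp
    have "measure lborel ?S \<le> measure lborel (ball x \<epsilon>)"
      by (rule measure_mono_fmeasurable) auto
    also have "\<dots> \<le> 10 * pi * \<epsilon> * s"
      using 1 \<open>\<epsilon> = 1\<close> by (simp add: measure_ball_complex)
    finally show ?thesis .
  next
    case 2
    have "z \<notin> ?S" for z
      using 2 norm_triangle_ineq2[of x z] by (auto simp: dist_norm)
    then have "?S = {}" by blast
    then show ?thesis using assms by simp
  next
    case 3
    define c where "c = 1 - s"
    have c: "0 < c" "c \<le> 1" using 3 assms by (auto simp: c_def)
    define A where "A = ball x \<epsilon> \<inter> ball 0 1"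
    define Y where "Y = ball x (\<epsilon> + s * cmod x) \<inter> ball 0 c"
    have mA: "A \<in> fmeasurable lborel" by (intro fin[of _ x \<epsilon>]) (auto simp: A_def)
    have mY: "Y \<in> fmeasurable lborel" by (intro fin[of _ x "\<epsilon> + s * cmod x"]) (auto simp: Y_def)
    have mB: "ball x \<epsilon> \<inter> ball 0 c \<in> fmeasurable lborel" by (intro fin[of _ x \<epsilon>]) auto
    have "z * of_real c \<in> Y" if z: "z \<in> A" for z
    proof -
      have "x - z * of_real c = of_real c * (x - z) + of_real s * x"
        by (simp add: c_def algebra_simps)
      then have "dist x (z * of_real c) \<le> cmod (of_real c * (x - z)) + cmod (of_real s * x)"
        unfolding dist_norm by (metis norm_triangle_ineq)
      also have "\<dots> = c * dist x z + s * cmod x"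
        using c assms by (simp add: norm_mult dist_norm)
      also have "c * dist x z \<le> dist x z"
        using c by (simp add: mult_left_le_one_le)
      also have "dist x z < \<epsilon>" using z by (simp add: A_def)
      finally show ?thesis
        using z c by (auto simp: A_def Y_def norm_mult)
    qed
    then have sub: "A \<subseteq> (\<lambda>z. 0 + c *\<^sub>R z) -` Y"
      by (auto simp: scaleR_conv_of_real mult.commute)
    have "ennreal (c\<^sup>2 * measure lborel A) = ennreal (c\<^sup>2) * emeasure lborel A"
      using mA by (simp add: emeasure_eq_measure2 ennreal_mult)
    also have "\<dots> \<le> ennreal (c\<^sup>2) * emeasure lborel ((\<lambda>z. 0 + c *\<^sub>R z) -` Y)"
    proof (intro mult_left_mono emeasure_mono sub)
      have "Y \<in> sets borel" using mY by (simp add: fmeasurable_def)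
      then show "(\<lambda>z. 0 + c *\<^sub>R z) -` Y \<in> sets lborel"
        using measurable_sets[of "\<lambda>z. 0 + c *\<^sub>R z" borel borel Y] by simp
    qed simp
    also have "\<dots> = emeasure (density (distr lborel borel (\<lambda>z. 0 + c *\<^sub>R z)) (\<lambda>_. \<bar>c\<bar>^DIM(complex))) Y"
      using mY c by (subst emeasure_density_const) (auto simp: emeasure_distr fmeasurable_def ennreal_power)
    also have "density (distr lborel borel (\<lambda>z::complex. 0 + c *\<^sub>R z)) (\<lambda>_. \<bar>c\<bar>^DIM(complex)) = lborel"
      by (rule lborel_affine[symmetric]) (use c in auto)
    also have "emeasure lborel Y = ennreal (measure lborel Y)"
      using mY by (simp add: emeasure_eq_measure2)
    finally have 1: "c\<^sup>2 * measure lborel A \<le> measure lborel Y"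
      by simp
    have "measure lborel Y \<le> measure lborel ((ball x \<epsilon> \<inter> ball 0 c) \<union> (ball x (\<epsilon> + s * cmod x) - ball x \<epsilon>))"
      by (rule measure_mono_fmeasurable) (use mY mB in \<open>auto simp: Y_def intro!: fmeasurable.Un fmeasurable.Diff\<close>)
    also have "\<dots> \<le> measure lborel (ball x \<epsilon> \<inter> ball 0 c) + measure lborel (ball x (\<epsilon> + s * cmod x) - ball x \<epsilon>)"
      by (rule measure_Un_le) auto
    also have "measure lborel (ball x (\<epsilon> + s * cmod x) - ball x \<epsilon>) = pi * (\<epsilon> + s * cmod x)\<^sup>2 - pi * \<epsilon>\<^sup>2"
    proof (subst measurable_measure_Diff)
      show "ball x \<epsilon> \<subseteq> ball x (\<epsilon> + s * cmod x)" using assms by (intro subset_ball) simp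
    qed (use assms in \<open>auto simp: measure_ball_complex\<close>)
    finally have 2: "measure lborel Y \<le> measure lborel (ball x \<epsilon> \<inter> ball 0 c) + (pi * (\<epsilon> + s * cmod x)\<^sup>2 - pi * \<epsilon>\<^sup>2)" .
    have S: "?S = A - (ball x \<epsilon> \<inter> ball 0 c)" by (auto simp: A_def c_def)
    have "measure lborel ?S = measure lborel A - measure lborel (ball x \<epsilon> \<inter> ball 0 c)"
      unfolding S by (rule measurable_measure_Diff) (use mA mB c in \<open>auto simp: A_def fmeasurable_def\<close>)
    also have "\<dots> \<le> (1 - c\<^sup>2) * measure lborel A + pi * (\<epsilon> + s * cmod x)\<^sup>2 - pi * \<epsilon>\<^sup>2"
      using 1 2 by (simp add: algebra_simps)
    also have "(1 - c\<^sup>2) * measure lborel A \<le> (2 * s) * (pi * \<epsilon>\<^sup>2)"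
    proof (rule mult_mono)
      show "1 - c\<^sup>2 \<le> 2 * s" by (simp add: c_def power2_eq_square algebra_simps)
      have "measure lborel A \<le> measure lborel (ball x \<epsilon>)"
        by (rule measure_mono_fmeasurable) (use mA in \<open>auto simp: A_def\<close>)
      then show "measure lborel A \<le> pi * \<epsilon>\<^sup>2" using assms by (simp add: measure_ball_complex)
    qed (use assms in auto)
    also have "2 * s * (pi * \<epsilon>\<^sup>2) + pi * (\<epsilon> + s * cmod x)\<^sup>2 - pi * \<epsilon>\<^sup>2 =
        pi * (2 * s * \<epsilon>\<^sup>2 + 2 * \<epsilon> * s * cmod x + s\<^sup>2 * (cmod x)\<^sup>2)"
      by (simp add: power2_eq_square algebra_simps)
    \<comment> \<open>The coefficients 2, 4 and 4 come from \<epsilon> \<le> 1, from |x| \<le> 2,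
      and from s \<le> \<epsilon> with |x| \<le> 2; they add up to 10.\<close>
    also have "\<dots> \<le> pi * (2 * s * \<epsilon> + 4 * \<epsilon> * s + 4 * \<epsilon> * s)"
    proof -
      have x: "cmod x \<le> 2" using 3 assms by simp
      have "2 * s * \<epsilon>\<^sup>2 \<le> 2 * s * \<epsilon>"
        using assms mult_left_mono[of \<epsilon> 1 "2 * s * \<epsilon>"] by (simp add: power2_eq_square)
      moreover have "2 * \<epsilon> * s * cmod x \<le> 4 * \<epsilon> * s"
        using mult_left_mono[OF x, of "2 * \<epsilon> * s"] assms by simp
      moreover have "s\<^sup>2 * (cmod x)\<^sup>2 \<le> (s * \<epsilon>) * 2\<^sup>2"
      proof (rule mult_mono)
        show "s\<^sup>2 \<le> s * \<epsilon>" using assms by (simp add: power2_eq_square mult_left_mono)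
        show "(cmod x)\<^sup>2 \<le> 2\<^sup>2" using x by (intro power_mono) auto
      qed (use assms in auto)
      ultimately show ?thesis
        by (intro mult_left_mono) (auto simp: mult_ac)
    qed
    also have "\<dots> = 10 * pi * \<epsilon> * s" by (simp add: algebra_simps)
    finally show ?thesis by simp
  qed
qed

text \<open>Substituting the shifted point \<open>radial_shift s z\<close> turns the angle \<open>2\<pi>t|z|\<close> into
  \<open>2\<pi>t(|z| + s)\<close>, so up to boundary and Jacobian terms of order \<open>\<epsilon> s\<close> the integral does not
  change when the twisted density is rotated by the angle \<open>2\<pi>ts\<close>.\<close>
lemma twisted_integral_rotate_close:
  fixes h :: "complex \<Rightarrow> real" and t s \<epsilon> :: real and x :: complex
  defines "w \<equiv> \<lambda>z. z * cis (2 * pi * t * (cmod z + s))"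
  assumes h [measurable]: "h \<in> borel_measurable borel"
    and bnd: "\<And>z. \<bar>h z\<bar> \<le> L" and supp: "\<And>z. 1 \<le> cmod z \<Longrightarrow> h z = 0"
    and s: "0 \<le> s" "s \<le> \<epsilon>" "\<epsilon> \<le> 1"
    and E: "(\<integral>z. indicator (ball x \<epsilon>) z * (indicator {z. cmod z < 1 - s} z *
        \<bar>h (radial_shift s (w z)) - h (w z)\<bar>) \<partial>lborel) \<le> E"
  shows "\<bar>(\<integral>z. indicator (ball x \<epsilon>) z * h (z * cis (2 * pi * t * cmod z)) \<partial>lborel) -
    (\<integral>z. indicator (ball x \<epsilon>) z * h (w z) \<partial>lborel)\<bar> \<le> 17 * pi * L * \<epsilon> * s + E"
proof -
  let ?B = "ball x \<epsilon>" and ?S = "radial_shift s"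
  have L: "0 \<le> L" using bnd[of 0] by linarith
  have [measurable]: "w \<in> borel_measurable borel" unfolding w_def by measurable
  have [measurable]: "ball x r \<in> sets borel" for r by simp
  define F where "F = (\<lambda>z. indicator ?B z * h (z * cis (2 * pi * t * cmod z)))"
  have [measurable]: "F \<in> borel_measurable borel" unfolding F_def by measurable
  have F_le: "\<bar>F z\<bar> \<le> L * indicator ?B z" for z
    using bnd by (auto simp: F_def split: split_indicator)
  have F_int: "integrable lborel F"
    by (rule integrable_bounded_on_ball[OF _ F_le]) measurable
  have S_sub: "indicator ?B (?S z) \<le> (indicator (ball x (\<epsilon> + s)) z :: real)" for z
    using dist_radial_shift[OF s(1), of z] dist_triangle[of x z "?S z"]
    by (auto split: split_indicator)
  have FS_le: "\<bar>F (?S z)\<bar> \<le> L * indicator (ball x (\<epsilon> + s)) z" for z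
    using F_le[of "?S z"] mult_left_mono[OF S_sub L, of z] by linarith
  have FS_int: "integrable lborel (\<lambda>z. F (?S z))"
    by (rule integrable_bounded_on_ball[OF _ FS_le]) measurable
  \<comment> \<open>At the shifted point the angle of the twist becomes that of \<open>w\<close>,
    and the shift commutes with this rotation.\<close>
  have FS: "F (?S z) = indicator ?B (?S z) * h (?S (w z))" if "z \<noteq> 0" for z
    using that s by (simp add: F_def w_def cmod_radial_shift radial_shift_mult)
  have J_int: "integrable lborel (\<lambda>z. indicator ?B z * h (w z))"
    by (rule integrable_bounded_on_ball[where M=L and x=x and r=\<epsilon>])
       (use bnd in \<open>auto split: split_indicator\<close>)

  \<comment> \<open>\<open>BS\<close> marks the preimage of the disk. The excess s/|z| over it is
    not integrated directly: the weight 1 + s/|z| integrates to the area of B outside the disk of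
    radius s, and the plain area of the preimage is subtracted.\<close>
  define BS where "BS = (\<lambda>z. indicator ?B (?S z) :: real)"
  have [measurable]: "BS \<in> borel_measurable borel" unfolding BS_def by measurable
  have BS_int: "integrable lborel BS"
    by (rule integrable_bounded_on_ball[where M=1 and x=x and r="\<epsilon> + s"])
       (use S_sub in \<open>auto simp: BS_def\<close>)
  have BS1_int: "integrable lborel (\<lambda>z. (1 + s / cmod z) * BS z)"
    unfolding BS_def by (rule integrable_radial_shift) (use s in auto)
  have BSs_int: "integrable lborel (\<lambda>z. s / cmod z * BS z)"
    using Bochner_Integration.integrable_diff[OF BS1_int BS_int] by (simp add: algebra_simps)
  have "(\<integral>z. s / cmod z * BS z \<partial>lborel) = (\<integral>z. (1 + s / cmod z) * BS z - BS z \<partial>lborel)"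
    by (simp add: algebra_simps)
  also have "\<dots> = (\<integral>z. (1 + s / cmod z) * BS z \<partial>lborel) - (\<integral>z. BS z \<partial>lborel)"
    using BS1_int BS_int by (rule Bochner_Integration.integral_diff)
  also have "(\<integral>z. (1 + s / cmod z) * BS z \<partial>lborel) = (\<integral>z. indicator {z. s < cmod z} z * indicator ?B z \<partial>lborel)"
    unfolding BS_def by (rule integral_radial_shift) (use s in auto)
  also have "\<dots> \<le> (\<integral>z. indicator ?B z \<partial>lborel)"
    by (rule integral_mono)
       (auto intro!: integrable_bounded_on_ball[where M=1 and x=x and r=\<epsilon>] split: split_indicator)
  also have "\<dots> = pi * \<epsilon>\<^sup>2"
    using s by (simp add: measure_ball_complex)
  \<comment> \<open>The preimage contains the concentric disk of radius \<epsilon> - s, as points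
    move by at most s.\<close>
  also have "(\<integral>z. BS z \<partial>lborel) \<ge> (\<integral>z. indicator (ball x (\<epsilon> - s)) z \<partial>lborel)"
  proof (rule integral_mono)
    show "indicator (ball x (\<epsilon> - s)) z \<le> BS z" for z
      using dist_radial_shift[OF s(1), of z] dist_triangle[of x "?S z" z]
      by (auto simp: BS_def dist_commute split: split_indicator)
  qed (use BS_int in auto)
  then have "pi * \<epsilon>\<^sup>2 - (\<integral>z. BS z \<partial>lborel) \<le> pi * \<epsilon>\<^sup>2 - pi * (\<epsilon> - s)\<^sup>2"
    using s by (simp add: measure_ball_complex)
  also have "\<dots> \<le> 2 * pi * \<epsilon> * s"
    by (simp add: power2_eq_square algebra_simps)
  finally have jac: "(\<integral>z. s / cmod z * BS z \<partial>lborel) \<le> 2 * pi * \<epsilon> * s"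
    by simp

  have Fs_le: "\<bar>s / cmod z * F (?S z)\<bar> \<le> L * (s / cmod z * BS z)" for z
  proof -
    have "\<bar>s / cmod z * F (?S z)\<bar> = s / cmod z * \<bar>F (?S z)\<bar>" using s by (simp add: abs_mult)
    also have "\<dots> \<le> s / cmod z * (L * BS z)"
      using F_le[of "?S z"] s by (intro mult_left_mono) (auto simp: BS_def)
    finally show ?thesis by (simp add: mult_ac)
  qed
  have Fs_int: "integrable lborel (\<lambda>z. s / cmod z * F (?S z))"
    using BSs_int by (rule Bochner_Integration.integrable_bound[OF integrable_mult_right[of L]])
      (use Fs_le order_trans[OF Fs_le abs_ge_self] in auto)
  have "\<bar>\<integral>z. s / cmod z * F (?S z) \<partial>lborel\<bar> \<le> (\<integral>z. \<bar>s / cmod z * F (?S z)\<bar> \<partial>lborel)"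
    by (rule integral_abs_bound)
  also have "\<dots> \<le> (\<integral>z. L * (s / cmod z * BS z) \<partial>lborel)"
    by (rule integral_mono[OF integrable_abs[OF Fs_int] integrable_mult_right[OF BSs_int]]) (rule Fs_le)
  also have "\<dots> = L * (\<integral>z. s / cmod z * BS z \<partial>lborel)"
    by (rule integral_mult_right_zero)
  also have "\<dots> \<le> L * (2 * pi * \<epsilon> * s)"
    by (rule mult_left_mono[OF jac L])
  finally have term2: "\<bar>\<integral>z. s / cmod z * F (?S z) \<partial>lborel\<bar> \<le> 2 * pi * L * \<epsilon> * s"
    by (simp add: mult_ac)

  \<comment> \<open>The image of the shift misses the disk of radius s, so this part is estimated by
    itself; s^2 \<le> \<epsilon> s keeps it of the required order.\<close>
  have in_int: "integrable lborel (\<lambda>z. indicator {z. cmod z \<le> s} z * F z)"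
    by (rule Bochner_Integration.integrable_bound[OF F_int]) (auto split: split_indicator)
  have out_int: "integrable lborel (\<lambda>z. indicator {z. s < cmod z} z * F z)"
    by (rule Bochner_Integration.integrable_bound[OF F_int]) (auto split: split_indicator)
  have "\<bar>\<integral>z. indicator {z. cmod z \<le> s} z * F z \<partial>lborel\<bar> \<le>
      (\<integral>z. \<bar>indicator {z. cmod z \<le> s} z * F z\<bar> \<partial>lborel)"
    by (rule integral_abs_bound)
  also have "\<dots> \<le> (\<integral>z. L * indicator (cball (0::complex) s) z \<partial>lborel)"
  proof (rule integral_mono)
    show "\<bar>indicator {z. cmod z \<le> s} z * F z\<bar> \<le> L * indicator (cball 0 s) z" for z
      using F_le[of z] L by (cases "z \<in> ?B") (auto split: split_indicator)
    show "integrable lborel (\<lambda>z. L * indicator (cball (0::complex) s) z)"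
      using emeasure_bounded_finite[OF bounded_cball, of "0::complex" s]
      by (intro integrable_mult_right integrable_real_indicator) auto
  qed (use in_int in auto)
  also have "\<dots> = L * (pi * s\<^sup>2)"
    using s by (simp add: content_cball unit_ball_vol_2)
  also have "\<dots> \<le> L * (pi * (\<epsilon> * s))"
    using s L by (intro mult_left_mono) (auto simp: power2_eq_square mult_right_mono)
  finally have term1: "\<bar>\<integral>z. indicator {z. cmod z \<le> s} z * F z \<partial>lborel\<bar> \<le> pi * L * \<epsilon> * s"
    by (simp add: mult_ac)

  have "(\<integral>z. F z \<partial>lborel) = (\<integral>z. indicator {z. cmod z \<le> s} z * F z + indicator {z. s < cmod z} z * F z \<partial>lborel)"
    by (intro Bochner_Integration.integral_cong) (auto split: split_indicator)
  also have "\<dots> = (\<integral>z. indicator {z. cmod z \<le> s} z * F z \<partial>lborel) + (\<integral>z. indicator {z. s < cmod z} z * F z \<partial>lborel)"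
    by (rule Bochner_Integration.integral_add[OF in_int out_int])
  also have "(\<integral>z. indicator {z. s < cmod z} z * F z \<partial>lborel) = (\<integral>z. (1 + s / cmod z) * F (?S z) \<partial>lborel)"
    by (rule integral_radial_shift[OF F_int s(1), symmetric])
  also have "\<dots> = (\<integral>z. F (?S z) + s / cmod z * F (?S z) \<partial>lborel)"
    by (simp add: algebra_simps)
  also have "\<dots> = (\<integral>z. F (?S z) \<partial>lborel) + (\<integral>z. s / cmod z * F (?S z) \<partial>lborel)"
    by (rule Bochner_Integration.integral_add[OF FS_int Fs_int])
  finally have split: "(\<integral>z. F z \<partial>lborel) = (\<integral>z. indicator {z. cmod z \<le> s} z * F z \<partial>lborel) +
      ((\<integral>z. F (?S z) \<partial>lborel) + (\<integral>z. s / cmod z * F (?S z) \<partial>lborel))" .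

  \<comment> \<open>Where the shifted and the rotated integrand can differ: \<open>ann\<close>
    contains the z for which exactly one of z and \<open>?S z\<close> lies in B,
    \<open>strip\<close> the points pushed across the unit circle, where h may jump to 0, and
    \<open>D\<close> is the difference that the hypothesis bounds by E.\<close>
  define ann where "ann = ball x (\<epsilon> + s) - ball x (\<epsilon> - s)"
  define strip where "strip = ?B \<inter> {z. 1 - s \<le> cmod z \<and> cmod z < 1}"
  define D where "D = (\<lambda>z. indicator ?B z * (indicator {z. cmod z < 1 - s} z * \<bar>h (?S (w z)) - h (w z)\<bar>))"
  have D_le: "\<bar>D z\<bar> \<le> (2 * L) * indicator ?B z" for z
    using bnd[of "?S (w z)"] bnd[of "w z"] by (auto simp: D_def split: split_indicator)
  have [measurable]: "D \<in> borel_measurable borel" unfolding D_def by measurable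
  have D_int: "integrable lborel D"
    by (rule integrable_bounded_on_ball[OF _ D_le]) measurable
  have [measurable]: "ann \<in> sets borel" "strip \<in> sets borel"
    by (auto simp: ann_def strip_def)
  have ann_int: "integrable lborel (indicator ann :: complex \<Rightarrow> real)"
    by (rule integrable_bounded_on_ball[where M=1 and x=x and r="\<epsilon> + s"])
       (auto simp: ann_def split: split_indicator)
  have strip_int: "integrable lborel (indicator strip :: complex \<Rightarrow> real)"
    by (rule integrable_bounded_on_ball[where M=1 and x=x and r="\<epsilon>"])
       (auto simp: strip_def split: split_indicator)
  have "measure lborel ann = pi * (\<epsilon> + s)\<^sup>2 - pi * (\<epsilon> - s)\<^sup>2"
    unfolding ann_def
  proof (subst measurable_measure_Diff)
    show "ball x (\<epsilon> - s) \<subseteq> ball x (\<epsilon> + s)" using s by (intro subset_ball) simp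
  qed (use s in \<open>auto simp: measure_ball_complex\<close>)
  then have ann: "measure lborel ann = 4 * pi * \<epsilon> * s"
    by (simp add: power2_eq_square algebra_simps)
  have strip: "measure lborel strip \<le> 10 * pi * \<epsilon> * s"
    unfolding strip_def by (rule measure_ball_strip_le) (use s in auto)

  have pw: "\<bar>F (?S z) - indicator ?B z * h (w z)\<bar> \<le> L * indicator ann z + (L * indicator strip z + D z)"
    if z: "z \<noteq> 0" for z
  proof -
    have [simp]: "cmod (w z) = cmod z" by (simp add: w_def norm_mult)
    have "w z \<noteq> 0" using z by (metis \<open>cmod (w z) = cmod z\<close> norm_eq_zero)
    then have [simp]: "cmod (?S (w z)) = cmod z + s" using s by (simp add: cmod_radial_shift)
    have 1: "\<bar>indicator ?B (?S z) * h (?S (w z)) - indicator ?B z * h (?S (w z))\<bar> \<le> L * indicator ann z"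
    proof -
      have "z \<in> ann" if "(?S z \<in> ?B) \<noteq> (z \<in> ?B)"
        using that dist_radial_shift[OF s(1), of z] dist_triangle[of x "?S z" z] dist_triangle[of x z "?S z"]
          s by (auto simp: ann_def dist_commute)
      then show ?thesis
        using bnd[of "?S (w z)"] L by (auto split: split_indicator)
    qed
    have 2: "\<bar>indicator ?B z * h (?S (w z)) - indicator ?B z * h (w z)\<bar> \<le> L * indicator strip z + D z"
    proof (cases "z \<in> ?B")
      case True
      consider "cmod z < 1 - s" | "1 - s \<le> cmod z" "cmod z < 1" | "1 \<le> cmod z" by linarith
      then show ?thesis
      proof cases
        case 1 then show ?thesis using True L by (auto simp: D_def)
      next
        case 2 then show ?thesis using True supp[of "?S (w z)"] bnd[of "w z"] by (auto simp: D_def strip_def)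
      next
        case 3 then show ?thesis using True supp[of "?S (w z)"] supp[of "w z"] s L by (auto simp: D_def)
      qed
    qed (use L in \<open>auto simp: D_def\<close>)
    show ?thesis using 1 2 unfolding FS[OF z] by linarith
  qed
  have "\<bar>(\<integral>z. F (?S z) \<partial>lborel) - (\<integral>z. indicator ?B z * h (w z) \<partial>lborel)\<bar> =
      \<bar>\<integral>z. F (?S z) - indicator ?B z * h (w z) \<partial>lborel\<bar>"
    by (subst Bochner_Integration.integral_diff[OF FS_int J_int]) simp
  also have "\<dots> \<le> (\<integral>z. \<bar>F (?S z) - indicator ?B z * h (w z)\<bar> \<partial>lborel)"
    by (rule integral_abs_bound)
  also have "\<dots> \<le> (\<integral>z. L * indicator ann z + (L * indicator strip z + D z) \<partial>lborel)"
  proof (rule integral_mono_AE)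
    show "AE z in lborel. \<bar>F (?S z) - indicator ?B z * h (w z)\<bar> \<le> L * indicator ann z + (L * indicator strip z + D z)"
      using AE_lborel_singleton[of "0::complex"] by eventually_elim (rule pw)
    show "integrable lborel (\<lambda>z. L * indicator ann z + (L * indicator strip z + D z))"
      by (intro Bochner_Integration.integrable_add integrable_mult_right ann_int strip_int D_int)
    show "integrable lborel (\<lambda>z. \<bar>F (?S z) - indicator ?B z * h (w z)\<bar>)"
      by (intro integrable_abs Bochner_Integration.integrable_diff FS_int J_int)
  qed
  also have "\<dots> = L * measure lborel ann + (L * measure lborel strip + (\<integral>z. D z \<partial>lborel))"
    by (subst Bochner_Integration.integral_add Bochner_Integration.integral_add[OF integrable_mult_right[OF strip_int] D_int],
        intro integrable_mult_right ann_int,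
        intro Bochner_Integration.integrable_add integrable_mult_right ann_int strip_int D_int)
       (simp add: Bochner_Integration.integral_add[OF integrable_mult_right[OF strip_int] D_int])
  also have "\<dots> \<le> L * (4 * pi * \<epsilon> * s) + (L * (10 * pi * \<epsilon> * s) + E)"
    using E by (intro add_mono mult_left_mono strip L) (auto simp: ann D_def)
  finally have term3: "\<bar>(\<integral>z. F (?S z) \<partial>lborel) - (\<integral>z. indicator ?B z * h (w z) \<partial>lborel)\<bar> \<le> 14 * pi * L * \<epsilon> * s + E"
    by (simp add: algebra_simps)
  have "\<bar>(\<integral>z. F z \<partial>lborel) - (\<integral>z. indicator ?B z * h (w z) \<partial>lborel)\<bar> \<le>
      pi * L * \<epsilon> * s + 2 * pi * L * \<epsilon> * s + (14 * pi * L * \<epsilon> * s + E)"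
    unfolding split using term1 term2 term3 by linarith
  then show ?thesis
    by (simp add: F_def algebra_simps)
qed

text \<open>E is asked for every twist \<open>a\<close> because the twist met in the proof,
  \<open>\<lambda>r. 2 * pi * t * (r + s)\<close>, varies with s. The condition 1/t \<le> \<epsilon>
  keeps every shift used below \<epsilon>.\<close>

lemma twisted_integral_le:
  fixes h :: "complex \<Rightarrow> real" and t \<epsilon> :: real and x :: complex
  assumes h [measurable]: "h \<in> borel_measurable borel"
    and bnd: "\<And>z. \<bar>h z\<bar> \<le> L" and supp: "\<And>z. 1 \<le> cmod z \<Longrightarrow> h z = 0"
    and mean: "AE r in lborel. 0 < r \<longrightarrow> (\<integral>u. h (of_real r * u) \<partial>circle_measure) = 0"
    and t: "0 < t" "1 / t \<le> \<epsilon>" "\<epsilon> \<le> 1"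
    and E: "\<And>s a. 0 \<le> s \<Longrightarrow> s < 1 / t \<Longrightarrow> a \<in> borel_measurable borel \<Longrightarrow>
      (\<integral>z. indicator (ball x \<epsilon>) z * (indicator {z. cmod z < 1 - s} z *
        \<bar>h (radial_shift s (z * cis (a (cmod z)))) - h (z * cis (a (cmod z)))\<bar>) \<partial>lborel) \<le> E"
  shows "\<bar>\<integral>z. indicator (ball x \<epsilon>) z * h (z * cis (2 * pi * t * cmod z)) \<partial>lborel\<bar> \<le> 17 * pi * L * \<epsilon> / t + E"
proof -
  let ?B = "ball x \<epsilon>"
  define T where "T = (\<lambda>z. z * cis (2 * pi * t * cmod z))"
  have [measurable]: "T \<in> borel_measurable borel" unfolding T_def by measurable
  have [measurable]: "ball x r \<in> sets borel" for r by simp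
  have L: "0 \<le> L" using bnd[of 0] by linarith
  define I where "I = (\<integral>z. indicator ?B z * h (T z) \<partial>lborel)"
  define J where "J = (\<lambda>u. \<integral>z. indicator ?B z * h (T z * u) \<partial>lborel)"
  have int: "integrable (lborel \<Otimes>\<^sub>M circle_measure) (\<lambda>(z, u). indicator ?B z * h (T z * u))"
  proof (rule integrableI_bounded_set[where A = "?B \<times> UNIV" and B = L])
    show "emeasure (lborel \<Otimes>\<^sub>M circle_measure) (?B \<times> UNIV) < \<infinity>"
      using emeasure_bounded_finite[OF bounded_ball, of x \<epsilon>]
      by (subst circle_measure.emeasure_pair_measure_Times)
         (auto simp: emeasure_circle_measure_UNIV ennreal_mult_less_top)
    show "AE p in lborel \<Otimes>\<^sub>M circle_measure. p \<notin> ?B \<times> UNIV \<longrightarrow>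
        (case p of (z, u) \<Rightarrow> indicator ?B z * h (T z * u)) = 0"
      by (rule AE_I2) (auto simp: indicator_def split: if_splits)
  qed (use bnd in \<open>auto split: split_indicator\<close>)
  have J_meas [measurable]: "J \<in> borel_measurable borel"
    unfolding J_def by measurable
  have J_int: "integrable circle_measure J"
    unfolding J_def using circle_pair.integrable_snd[OF int] by simp
  have "(\<integral>u. J u \<partial>circle_measure) = (\<integral>z. (\<integral>u. indicator ?B z * h (T z * u) \<partial>circle_measure) \<partial>lborel)"
    unfolding J_def by (rule circle_pair.Fubini_integral[OF int])
  also have "\<dots> = 0"
  proof (rule integral_eq_zero_AE)
    \<comment> \<open>Circle means vanish only from almost every base point; composing with the
      twist is harmless because it pulls null sets back to null sets.\<close>
    have "AE z in lborel. (\<integral>u. h (T z * u) \<partial>circle_measure) = 0"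
      unfolding T_def by (rule AE_lborel_twist[OF AE_circle_mean_zero[OF h mean]]) measurable
    then show "AE z in lborel. (\<integral>u. indicator ?B z * h (T z * u) \<partial>circle_measure) = 0"
      by eventually_elim simp
  qed
  finally have J0: "(\<integral>u. J u \<partial>circle_measure) = 0" .
  define K where "K = 17 * pi * L * \<epsilon> / t + E"
  have K: "AE u in circle_measure. \<bar>I - J u\<bar> \<le> K"
  proof (rule AE_circle_measure)
    fix \<theta> :: real assume \<theta>: "0 \<le> \<theta>" "\<theta> < 2 * pi"
    \<comment> \<open>The shift that realises the rotation by \<theta>; one full turn corresponds to
      0 \<le> s < 1/t.\<close>
    define s where "s = \<theta> / (2 * pi * t)"
    have s: "0 \<le> s" "s < 1 / t" "\<theta> = 2 * pi * t * s"
      using \<theta> t by (auto simp: s_def field_simps)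
    have w: "T z * cis \<theta> = z * cis (2 * pi * t * (cmod z + s))" for z
      by (simp add: T_def s(3) mult.assoc cis_mult distrib_left)
    have "\<bar>I - J (cis \<theta>)\<bar> \<le> 17 * pi * L * \<epsilon> * s + E"
      unfolding I_def J_def w unfolding T_def
      by (rule twisted_integral_rotate_close[OF h bnd supp])
         (use s t E[of s "\<lambda>r. 2 * pi * t * (r + s)"] in auto)
    also have "17 * pi * L * \<epsilon> * s \<le> 17 * pi * L * \<epsilon> * (1 / t)"
    proof (intro mult_left_mono)
      have "0 < 1 / t" using t by simp
      then have "0 \<le> \<epsilon>" using t by linarith
      then show "0 \<le> 17 * pi * L * \<epsilon>" using L by simp
    qed (use s in auto)
    finally show "\<bar>I - J (cis \<theta>)\<bar> \<le> K" by (simp add: K_def)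
  qed measurable
  have "2 * pi * I = (\<integral>u. I - J u \<partial>circle_measure)"
    by (subst Bochner_Integration.integral_diff)
       (auto simp: J_int J0 measure_def emeasure_circle_measure_UNIV)
  also have "\<bar>\<dots>\<bar> \<le> (\<integral>u. \<bar>I - J u\<bar> \<partial>circle_measure)"
    by (rule integral_abs_bound)
  also have "\<dots> \<le> (\<integral>u. K \<partial>circle_measure)"
    by (rule integral_mono_AE[OF _ _ K]) (auto simp: J_int)
  also have "\<dots> = 2 * pi * K"
    by (simp add: measure_def emeasure_circle_measure_UNIV)
  finally have "\<bar>I\<bar> \<le> K"
    by (simp add: abs_mult)
  then show ?thesis
    by (simp add: I_def K_def T_def)
qed

subsection \<open>Mean oscillation at a given scale\<close>

text \<open>An unnormalised L1 modulus of continuity, the common target of the fractional kernel and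
  of the weak gradient. Values in \<open>ennreal\<close> keep Fubini free of integrability
  conditions, and the condition on \<open>y - z\<close> is ready for the substitution y = z +
  v.\<close>

definition osc :: "(complex \<Rightarrow> real) \<Rightarrow> real \<Rightarrow> ennreal" where
  "osc f d = (\<integral>\<^sup>+z. \<integral>\<^sup>+y. indicator (ball 0 1) z * indicator (ball 0 1) y *
     indicator (ball 0 d) (y - z) * ennreal \<bar>f z - f y\<bar> \<partial>lborel \<partial>lborel)"

text \<open>The value at an intermediate point \<open>y\<close> close to both \<open>z\<close> and its shift is inserted and averaged over a
  disk of radius \<open>\<delta>/2\<close> inside the unit disk.\<close>
lemma radial_shift_diff_le_osc:
  fixes h :: "complex \<Rightarrow> real"
  assumes [measurable]: "h \<in> borel_measurable borel" and s: "0 \<le> s" "s \<le> \<delta>" and \<delta>: "0 < \<delta>" "\<delta> \<le> 1"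
  shows "(\<integral>\<^sup>+z. indicator {z. cmod z < 1 - s} z * ennreal \<bar>h (radial_shift s z) - h z\<bar> \<partial>lborel) *
    ennreal (pi * \<delta>\<^sup>2 / 4) \<le> 2 * osc h (2 * \<delta>)"
proof -
  let ?D = "ball 0 1 :: complex set" and ?S = "radial_shift s"
  have [measurable]: "ball x r \<in> sets borel" for x :: complex and r by simp
  define k where "k = (\<lambda>z y. indicator ?D z * indicator ?D y *
     indicator (ball 0 (2 * \<delta>)) (y - z) * ennreal \<bar>h z - h y\<bar>)"
  have [measurable]: "case_prod k \<in> borel_measurable (borel \<Otimes>\<^sub>M borel)"
    unfolding k_def by measurable
  define Q where "Q = (\<lambda>z. \<integral>\<^sup>+y. k z y \<partial>lborel)"
  have [measurable]: "Q \<in> borel_measurable borel" unfolding Q_def by measurable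
  have osc: "osc h (2 * \<delta>) = (\<integral>\<^sup>+z. Q z \<partial>lborel)" by (simp add: osc_def Q_def k_def)
  \<comment> \<open>The centre is pulled towards 0 by the factor 1 - \<delta>/2, so that the disk of
    radius \<delta>/2 stays inside the unit disk and within distance \<delta> of z even near the
    boundary. As s \<le> \<delta>, it is within 2 \<delta> of the shifted point.\<close>
  define V where "V = (\<lambda>z::complex. ball (of_real (1 - \<delta> / 2) * z) (\<delta> / 2))"
  have V: "emeasure lborel (V z) = ennreal (pi * \<delta>\<^sup>2 / 4)" for z
    using \<delta> by (simp add: V_def emeasure_ball unit_ball_vol_2 power_divide)
  have [measurable]: "V z \<in> sets borel" for z by (simp add: V_def)
  have pw: "ennreal \<bar>h (?S z) - h z\<bar> * indicator (V z) y \<le> k (?S z) y + k z y" if z: "cmod z < 1 - s" for z y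
  proof (cases "y \<in> V z")
    case True
    define c where "c = 1 - \<delta> / 2"
    have c: "0 \<le> c" using \<delta> by (simp add: c_def)
    have y: "cmod (of_real c * z - y) < \<delta> / 2" using True by (simp add: V_def c_def dist_norm)
    have "cmod z \<le> 1" using z s by simp
    have cz: "cmod (of_real c * z) \<le> c"
      using c \<open>cmod z \<le> 1\<close> by (simp add: norm_mult mult_left_le)
    have "cmod y \<le> cmod (of_real c * z) + cmod (of_real c * z - y)"
      using norm_triangle_ineq4[of "of_real c * z" "of_real c * z - y"] by simp
    then have yD: "cmod y < 1" using cz y by (simp add: c_def)
    have "y - z = - (of_real c * z - y) - of_real (\<delta> / 2) * z"
      by (simp add: c_def algebra_simps)
    then have "cmod (y - z) \<le> cmod (of_real c * z - y) + cmod (of_real (\<delta> / 2) * z)"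
      by (metis norm_minus_cancel norm_triangle_ineq4)
    also have "cmod (of_real (\<delta> / 2) * z) \<le> \<delta> / 2"
      using \<delta> \<open>cmod z \<le> 1\<close> by (simp add: norm_mult mult_left_le)
    finally have yz: "cmod (y - z) < \<delta>" using y by linarith
    have Sz: "cmod (?S z - z) \<le> s" using dist_radial_shift[OF s(1), of z] by (simp add: dist_norm)
    have "cmod (?S z) \<le> cmod z + s"
      using norm_triangle_ineq[of z "?S z - z"] Sz by simp
    then have SD: "cmod (?S z) < 1" using z by simp
    have "cmod (y - ?S z) \<le> cmod (y - z) + cmod (?S z - z)"
      using norm_triangle_ineq4[of "y - z" "?S z - z"] by simp
    then have yS: "cmod (y - ?S z) < 2 * \<delta>" using yz Sz s by linarith
    have "ennreal \<bar>h (?S z) - h z\<bar> \<le> ennreal (\<bar>h (?S z) - h y\<bar> + \<bar>h z - h y\<bar>)"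
      by (intro ennreal_leI) linarith
    also have "\<dots> = k (?S z) y + k z y"
      using SD yD yS yz \<delta> \<open>cmod z < 1 - s\<close> s by (simp add: k_def)
    finally show ?thesis using True by simp
  qed simp
  have "(\<integral>\<^sup>+z. indicator {z. cmod z < 1 - s} z * ennreal \<bar>h (?S z) - h z\<bar> \<partial>lborel) * ennreal (pi * \<delta>\<^sup>2 / 4) =
    (\<integral>\<^sup>+z. indicator {z. cmod z < 1 - s} z * ennreal \<bar>h (?S z) - h z\<bar> * ennreal (pi * \<delta>\<^sup>2 / 4) \<partial>lborel)"
    by (rule nn_integral_multc[symmetric]) measurable
  also have "\<dots> \<le> (\<integral>\<^sup>+z. Q (?S z) + Q z \<partial>lborel)"
  proof (rule nn_integral_mono)
    fix z
    have "ennreal \<bar>h (?S z) - h z\<bar> * ennreal (pi * \<delta>\<^sup>2 / 4) \<le> Q (?S z) + Q z" if z: "cmod z < 1 - s"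
    proof -
      have "ennreal \<bar>h (?S z) - h z\<bar> * ennreal (pi * \<delta>\<^sup>2 / 4) =
          (\<integral>\<^sup>+y. ennreal \<bar>h (?S z) - h z\<bar> * indicator (V z) y \<partial>lborel)"
        by (subst nn_integral_cmult) (auto simp: V)
      also have "\<dots> \<le> (\<integral>\<^sup>+y. k (?S z) y + k z y \<partial>lborel)"
        by (rule nn_integral_mono) (rule pw[OF z])
      also have "\<dots> = Q (?S z) + Q z"
        unfolding Q_def by (rule nn_integral_add) measurable
      finally show ?thesis .
    qed
    then show "indicator {z. cmod z < 1 - s} z * ennreal \<bar>h (?S z) - h z\<bar> * ennreal (pi * \<delta>\<^sup>2 / 4) \<le> Q (?S z) + Q z"
      by (auto split: split_indicator)
  qed
  also have "\<dots> = (\<integral>\<^sup>+z. Q (?S z) \<partial>lborel) + (\<integral>\<^sup>+z. Q z \<partial>lborel)"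
    by (rule nn_integral_add) measurable
  finally have le: "(\<integral>\<^sup>+z. indicator {z. cmod z < 1 - s} z * ennreal \<bar>h (?S z) - h z\<bar> \<partial>lborel) *
      ennreal (pi * \<delta>\<^sup>2 / 4) \<le> (\<integral>\<^sup>+z. Q (?S z) \<partial>lborel) + (\<integral>\<^sup>+z. Q z \<partial>lborel)" .
  \<comment> \<open>The weight 1 + s/|z| is at least 1, so it may be inserted before the shift is
    substituted away.\<close>
  have "(\<integral>\<^sup>+z. Q (?S z) \<partial>lborel) \<le> (\<integral>\<^sup>+z. Q (?S z) * ennreal (1 + s / cmod z) \<partial>lborel)"
  proof (rule nn_integral_mono)
    fix z
    have "Q (?S z) * ennreal 1 \<le> Q (?S z) * ennreal (1 + s / cmod z)"
      using s by (intro mult_left_mono ennreal_leI) auto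
    then show "Q (?S z) \<le> Q (?S z) * ennreal (1 + s / cmod z)" by simp
  qed
  also have "\<dots> = (\<integral>\<^sup>+z. indicator {z. s < cmod z} z * Q z \<partial>lborel)"
    by (rule nn_integral_radial_shift) (use s in auto)
  also have "\<dots> \<le> (\<integral>\<^sup>+z. Q z \<partial>lborel)"
    by (rule nn_integral_mono) (auto split: split_indicator)
  finally have "(\<integral>\<^sup>+z. Q (?S z) \<partial>lborel) + (\<integral>\<^sup>+z. Q z \<partial>lborel) \<le> 2 * (\<integral>\<^sup>+z. Q z \<partial>lborel)"
    unfolding mult_2 by (rule add_right_mono)
  with le show ?thesis
    unfolding osc by (rule order_trans)
qed

text \<open>For |x - y| < d the fractional integrand is at least
  \<open>d powr - (2 + \<alpha>)\<close> times |f x - f y|. On the diagonal both vanish, since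
  division by zero gives 0.\<close>

lemma osc_le_fractional_seminorm:
  assumes [measurable]: "f \<in> borel_measurable borel" and \<alpha>: "0 < \<alpha>" "\<alpha> < 1" and d: "0 < d"
  shows "osc f d \<le> ennreal (d powr (2 + \<alpha>)) * W_alpha_1_seminorm \<alpha> f"
proof -
  have [measurable]: "ball x r \<in> sets borel" for x :: complex and r by simp
  let ?k = "\<lambda>x y. indicator (ball 0 1) x * indicator (ball 0 1) y *
           ennreal (\<bar>f x - f y\<bar> / cmod (x - y) powr (2 + \<alpha>))"
  have "osc f d \<le> (\<integral>\<^sup>+x. \<integral>\<^sup>+y. ennreal (d powr (2 + \<alpha>)) * ?k x y \<partial>lborel \<partial>lborel)"
    unfolding osc_def
  proof (intro nn_integral_mono)
    fix x y :: complex
    have "\<bar>f x - f y\<bar> \<le> d powr (2 + \<alpha>) * (\<bar>f x - f y\<bar> / cmod (x - y) powr (2 + \<alpha>))" if "cmod (y - x) < d"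
    proof (cases "x = y")
      case False
      have "cmod (x - y) powr (2 + \<alpha>) \<le> d powr (2 + \<alpha>)"
        using that \<alpha> by (intro powr_mono2) (auto simp: norm_minus_commute)
      then have "\<bar>f x - f y\<bar> * cmod (x - y) powr (2 + \<alpha>) \<le> \<bar>f x - f y\<bar> * d powr (2 + \<alpha>)"
        by (rule mult_left_mono) simp
      then show ?thesis using False by (simp add: field_simps)
    qed simp
    then show "indicator (ball 0 1) x * indicator (ball 0 1) y * indicator (ball 0 d) (y - x) *
        ennreal \<bar>f x - f y\<bar> \<le> ennreal (d powr (2 + \<alpha>)) * ?k x y"
      by (auto simp: ennreal_mult[symmetric] simp del: ennreal_le_iff intro!: ennreal_leI split: split_indicator)
  qed
  also have "\<dots> = ennreal (d powr (2 + \<alpha>)) * (\<integral>\<^sup>+x. \<integral>\<^sup>+y. ?k x y \<partial>lborel \<partial>lborel)"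
    by (subst nn_integral_cmult[symmetric], measurable)
       (intro nn_integral_cong nn_integral_cmult, measurable)
  finally show ?thesis
    using \<alpha> by (simp add: W_alpha_1_seminorm_def)
qed

text \<open>With y = z + v the double integral becomes one over |v| < d of translation differences,
  each at most d W; the area pi d^2 supplies the remaining factors.\<close>

lemma osc_le_translations:
  fixes f :: "complex \<Rightarrow> real"
  assumes [measurable]: "f \<in> borel_measurable borel" and d: "0 \<le> d"
    and tr: "\<And>v. (\<integral>\<^sup>+z. indicator (ball 0 1) z * indicator (ball 0 1) (z + v) * ennreal \<bar>f (z + v) - f z\<bar> \<partial>lborel)
      \<le> ennreal (cmod v) * W"
  shows "osc f d \<le> ennreal (pi * d ^ 3) * W"
proof -
  let ?D = "ball 0 1 :: complex set"
  have [measurable]: "ball x r \<in> sets borel" for x :: complex and r by simp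
  have "osc f d = (\<integral>\<^sup>+z. \<integral>\<^sup>+v. indicator ?D z * indicator ?D (v + z) *
     indicator (ball 0 d) (v + z - z) * ennreal \<bar>f z - f (v + z)\<bar> \<partial>lborel \<partial>lborel)"
    unfolding osc_def
    by (intro nn_integral_cong nn_integral_lborel_translate[symmetric]) measurable
  also have "\<dots> = (\<integral>\<^sup>+v. \<integral>\<^sup>+z. indicator ?D z * indicator ?D (v + z) *
     indicator (ball 0 d) (v + z - z) * ennreal \<bar>f z - f (v + z)\<bar> \<partial>lborel \<partial>lborel)"
    by (rule lborel_pair.Fubini') measurable
  also have "\<dots> = (\<integral>\<^sup>+v. indicator (ball 0 d) v * (\<integral>\<^sup>+z. indicator ?D z * indicator ?D (z + v) *
       ennreal \<bar>f (z + v) - f z\<bar> \<partial>lborel) \<partial>lborel)"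
    by (subst nn_integral_cmult[symmetric], measurable)
       (simp add: mult_ac add_ac abs_minus_commute)
  also have "\<dots> \<le> (\<integral>\<^sup>+v. indicator (ball 0 d) (v::complex) * (ennreal d * W) \<partial>lborel)"
  proof (rule nn_integral_mono)
    fix v :: complex
    have "ennreal (cmod v) * W \<le> ennreal d * W" if "cmod v < d"
      using that by (intro mult_right_mono ennreal_leI) auto
    then show "indicator (ball 0 d) v * (\<integral>\<^sup>+z. indicator ?D z * indicator ?D (z + v) *
       ennreal \<bar>f (z + v) - f z\<bar> \<partial>lborel) \<le> indicator (ball 0 d) v * (ennreal d * W)"
      using order_trans[OF tr[of v]] by (auto split: split_indicator)
  qed
  also have "\<dots> = emeasure lborel (ball (0::complex) d) * (ennreal d * W)"
    by (simp add: nn_integral_multc)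
  also have "\<dots> = ennreal (pi * d ^ 3) * W"
    using d by (simp add: emeasure_ball unit_ball_vol_2 mult.assoc[symmetric] ennreal_mult[symmetric]
        power3_eq_cube power2_eq_square)
  finally show ?thesis .
qed

subsection \<open>Translations and weak gradients\<close>

text \<open>Continuity is asked of each directional derivative, as in \<open>test_fun_B1\<close>.
  With the derivative as a witness, closure under sums, products and composition amounts to
  exhibiting it.\<close>

definition C1_fun :: "(complex \<Rightarrow> real) \<Rightarrow> bool" where
  "C1_fun f \<longleftrightarrow> (\<exists>f'. (\<forall>x. (f has_derivative f' x) (at x)) \<and> (\<forall>w. continuous_on UNIV (\<lambda>x. f' x w)))"

lemma C1_fun_continuous: "C1_fun f \<Longrightarrow> continuous_on UNIV f"
  unfolding C1_fun_def by (meson continuous_at_imp_continuous_on has_derivative_continuous)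

lemma C1_fun_const [simp]: "C1_fun (\<lambda>x. c)"
  unfolding C1_fun_def by (intro exI[of _ "\<lambda>x w. 0"]) auto

lemma C1_fun_bounded_linear: "bounded_linear f \<Longrightarrow> C1_fun f"
  unfolding C1_fun_def by (intro exI[of _ "\<lambda>x. f"]) (auto intro: bounded_linear_imp_has_derivative)

lemma C1_fun_add:
  assumes "C1_fun f" "C1_fun g"
  shows "C1_fun (\<lambda>x. f x + g x)"
proof -
  from assms obtain f' g' where "\<And>x. (f has_derivative f' x) (at x)" "\<And>w. continuous_on UNIV (\<lambda>x. f' x w)"
    "\<And>x. (g has_derivative g' x) (at x)" "\<And>w. continuous_on UNIV (\<lambda>x. g' x w)"
    unfolding C1_fun_def by metis
  then show ?thesis
    unfolding C1_fun_def
    by (intro exI[of _ "\<lambda>x w. f' x w + g' x w"]) (auto intro!: has_derivative_add continuous_intros)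
qed

lemma C1_fun_mult:
  assumes "C1_fun f" "C1_fun g"
  shows "C1_fun (\<lambda>x. f x * g x)"
proof -
  from assms obtain f' g' where "\<And>x. (f has_derivative f' x) (at x)" "\<And>w. continuous_on UNIV (\<lambda>x. f' x w)"
    "\<And>x. (g has_derivative g' x) (at x)" "\<And>w. continuous_on UNIV (\<lambda>x. g' x w)"
    unfolding C1_fun_def by metis
  then show ?thesis
    unfolding C1_fun_def using assms[THEN C1_fun_continuous]
    by (intro exI[of _ "\<lambda>x w. f x * g' x w + f' x w * g x"]) (auto intro!: has_derivative_mult continuous_intros)
qed

lemma C1_fun_compose:
  assumes "C1_fun f" and \<psi>: "\<And>a. (\<psi> has_real_derivative \<psi>' a) (at a)" "continuous_on UNIV \<psi>'"
  shows "C1_fun (\<lambda>x. \<psi> (f x))"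
proof -
  from assms obtain f' where f': "\<And>x. (f has_derivative f' x) (at x)" "\<And>w. continuous_on UNIV (\<lambda>x. f' x w)"
    unfolding C1_fun_def by metis
  have "((\<lambda>x. \<psi> (f x)) has_derivative (\<lambda>w. \<psi>' (f x) * f' x w)) (at x)" for x
    using has_derivative_compose[OF f'(1) \<psi>(1)[unfolded has_field_derivative_def], of x] .
  moreover have "continuous_on UNIV (\<lambda>x. \<psi>' (f x) * f' x w)" for w
    using C1_fun_continuous[OF assms(1)] f'(2)
    by (intro continuous_intros continuous_on_compose2[OF \<psi>(2)]) auto
  ultimately show ?thesis
    unfolding C1_fun_def by (intro exI[of _ "\<lambda>x w. \<psi>' (f x) * f' x w"]) auto
qed

lemma C1_fun_real_polynomial: "real_polynomial_function p \<Longrightarrow> C1_fun p"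
  by (induction rule: real_polynomial_function.induct)
     (auto intro: C1_fun_bounded_linear C1_fun_add C1_fun_mult)

lemma test_fun_B1I:
  assumes "C1_fun f" "compact K" "K \<subseteq> ball 0 1" "\<And>x. x \<notin> K \<Longrightarrow> f x = 0"
  shows "test_fun_B1 f"
proof -
  obtain f' where f': "\<And>x. (f has_derivative f' x) (at x)" "\<And>w. continuous_on UNIV (\<lambda>x. f' x w)"
    using assms(1) unfolding C1_fun_def by metis
  have "frechet_derivative f (at x) = f' x" for x
    using frechet_derivative_at[OF f'(1)] by simp
  then show ?thesis
    unfolding test_fun_B1_def using f' assms by (auto simp: differentiable_def)
qed

text \<open>The square of the positive part is C1 although the positive part is not; the exponential
  keeps the values in [0, 1], and the factor n drives them to 1 for a > 0. Vanishing up to 1/(n + 1)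
  will give compact supports inside the disk.\<close>

definition cutoff :: "nat \<Rightarrow> real \<Rightarrow> real" where
  "cutoff n a = 1 - exp (- (real n * (max 0 (a - 1 / real (Suc n)))\<^sup>2))"

lemma C1_cutoff:
  fixes a :: real and n :: nat
  shows "0 \<le> cutoff n a" "cutoff n a \<le> 1" "a \<le> 1 / real (Suc n) \<Longrightarrow> cutoff n a = 0"
    and "0 < a \<Longrightarrow> (\<lambda>n. cutoff n a) \<longlonglongrightarrow> 1"
    and "C1_fun f \<Longrightarrow> C1_fun (\<lambda>x. cutoff n (f x))"
proof -
  show "0 \<le> cutoff n a" "cutoff n a \<le> 1" "a \<le> 1 / real (Suc n) \<Longrightarrow> cutoff n a = 0"
    by (auto simp: cutoff_def max_def)
  show "(\<lambda>n. cutoff n a) \<longlonglongrightarrow> 1" if a: "0 < a"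
  proof -
    have "(\<lambda>n. (max 0 (a - 1 / real (Suc n)))\<^sup>2) \<longlonglongrightarrow> (max 0 (a - 0))\<^sup>2"
      by (intro tendsto_intros LIMSEQ_Suc[OF lim_1_over_n])
    moreover have "0 < (max 0 (a - 0))\<^sup>2" using a by simp
    ultimately have "filterlim (\<lambda>n. (max 0 (a - 1 / real (Suc n)))\<^sup>2 * real n) at_top sequentially"
      by (rule filterlim_tendsto_pos_mult_at_top[OF _ _ filterlim_real_sequentially])
    then have "filterlim (\<lambda>n. - (real n * (max 0 (a - 1 / real (Suc n)))\<^sup>2)) at_bot sequentially"
      by (simp add: filterlim_uminus_at_top mult.commute)
    then have "(\<lambda>n. exp (- (real n * (max 0 (a - 1 / real (Suc n)))\<^sup>2))) \<longlonglongrightarrow> 0"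
      by (rule filterlim_compose[OF exp_at_bot])
    then show ?thesis
      unfolding cutoff_def using tendsto_diff[OF tendsto_const[of 1]] by fastforce
  qed
  \<comment> \<open>At 0 the difference quotient is 0 on the left and h on the right, so it tends to
    the value 0 of the formula.\<close>
  have sq: "((\<lambda>b. (max 0 b)\<^sup>2) has_real_derivative 2 * max 0 b) (at b)" for b :: real
  proof -
    consider "b < 0" | "b > 0" | "b = 0" by linarith
    then show ?thesis
    proof cases
      case 1
      have "((\<lambda>b. 0) has_real_derivative 2 * max 0 b) (at b)" using 1 by (auto simp: max_def)
      then show ?thesis
        by (rule has_field_derivative_transform_within_open[of _ _ _ "{..<0}"]) (use 1 in auto)
    next
      case 2
      have "((\<lambda>b. b\<^sup>2) has_real_derivative 2 * max 0 b) (at b)"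
        using 2 by (auto intro!: derivative_eq_intros)
      then show ?thesis
        by (rule has_field_derivative_transform_within_open[of _ _ _ "{0<..}"]) (use 2 in auto)
    next
      case 3
      have "((\<lambda>h. max 0 h) \<longlongrightarrow> max 0 0) (at (0::real))"
        by (intro tendsto_intros)
      then have "((\<lambda>h. max 0 h) \<longlongrightarrow> 0) (at (0::real))" by simp
      then have "((\<lambda>h. (max 0 h)\<^sup>2 / h) \<longlongrightarrow> 0) (at (0::real))"
        by (rule Lim_transform_eventually)
           (auto simp: eventually_at_filter max_def power2_eq_square intro!: always_eventually)
      then show ?thesis
        using 3 by (simp add: DERIV_def)
    qed
  qed
  show "C1_fun (\<lambda>x. cutoff n (f x))" if f: "C1_fun f"
  proof (rule C1_fun_compose[OF f])
    let ?m = "\<lambda>a. max 0 (a - 1 / real (Suc n))"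
    show "(cutoff n has_real_derivative exp (- (real n * (?m a)\<^sup>2)) * (real n * (2 * ?m a))) (at a)" for a
    proof -
      have "((\<lambda>a. (?m a)\<^sup>2) has_real_derivative 2 * ?m a * 1) (at a)"
        by (rule DERIV_chain2[where f = "\<lambda>b. (max 0 b)\<^sup>2", OF sq]) (auto intro!: derivative_eq_intros)
      then have *: "((\<lambda>a. (?m a)\<^sup>2) has_real_derivative 2 * ?m a) (at a)" by simp
      have "((\<lambda>a. 1 - exp (- (real n * u a))) has_real_derivative exp (- (real n * u a)) * (real n * D)) (at a)"
        if "(u has_real_derivative D) (at a)" for u D
        using that by (auto intro!: derivative_eq_intros)
      from this[OF *] show ?thesis
        unfolding cutoff_def[abs_def] .
    qed
    show "continuous_on UNIV (\<lambda>a. exp (- (real n * (?m a)\<^sup>2)) * (real n * (2 * ?m a)))"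
      by (intro continuous_intros)
  qed
qed

text \<open>A bounded measurable function is almost everywhere a limit of continuous functions, these are
  uniformly approximated by polynomials, and the polynomials are multiplied by \<open>C\<^sup>1\<close> cutoffs.\<close>
lemma test_functions_approximate:
  fixes S :: "complex \<Rightarrow> real" and v :: complex
  assumes S [measurable]: "S \<in> borel_measurable borel" and S1: "\<And>z. \<bar>S z\<bar> \<le> 1"
  obtains \<phi> where "\<And>n::nat. C1_fun (\<phi> n)" "\<And>n z. \<bar>\<phi> n z\<bar> \<le> 1"
    "\<And>n. \<exists>K. compact K \<and> K \<subseteq> ball 0 1 \<and> (\<lambda>z. z + v) ` K \<subseteq> ball 0 1 \<and> (\<forall>z. z \<notin> K \<longrightarrow> \<phi> n z = 0)"
    "AE z in lborel. z \<in> ball 0 1 \<and> z + v \<in> ball 0 1 \<longrightarrow> (\<lambda>n. \<phi> n z) \<longlonglongrightarrow> S z"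
proof -
  \<comment> \<open>\<open>measurable_on\<close> means by definition being a limit of continuous
    functions off a negligible set; Lebesgue measurability is the way there.\<close>
  have "S \<in> borel_measurable lebesgue"
    by (rule measurable_completion) simp
  then have "S measurable_on UNIV"
    by (rule lebesgue_measurable_imp_measurable_on) simp
  then obtain N g where N: "negligible N" and g: "\<And>n. continuous_on UNIV (g n)"
    and lim: "\<And>x. x \<notin> N \<Longrightarrow> (\<lambda>n::nat. g n x) \<longlonglongrightarrow> S x"
    unfolding measurable_on_def by auto
  \<comment> \<open>Clipping bounds the approximations by 1 without changing their limit; the
    polynomial error \<open>e n\<close> is later compensated by dividing by
    \<open>1 + e n\<close>.\<close>
  define g' where "g' = (\<lambda>n z. max (-1) (min 1 (g n z)))"
  have g': "continuous_on (cball 0 1) (g' n)" for n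
    unfolding g'_def using continuous_on_subset[OF g] by (intro continuous_intros) auto
  define e where "e = (\<lambda>n::nat. 1 / real (Suc n))"
  have e: "0 < e n" for n by (simp add: e_def)
  have e0: "e \<longlonglongrightarrow> 0" unfolding e_def by (intro LIMSEQ_Suc[OF lim_1_over_n])
  have "\<exists>p. real_polynomial_function p \<and> (\<forall>x\<in>cball 0 1. \<bar>g' n x - p x\<bar> < e n)" for n
    using Stone_Weierstrass_real_polynomial_function[OF compact_cball g' e] by metis
  then obtain p where p: "\<And>n. real_polynomial_function (p n)" "\<And>n x. x \<in> cball 0 1 \<Longrightarrow> \<bar>g' n x - p n x\<bar> < e n"
    by metis
  note q = C1_cutoff
  \<comment> \<open>Positive exactly when z + v lies in the unit disk, and a polynomial in the
    coordinates, hence C1 everywhere.\<close>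
  define a where "a = (\<lambda>v z::complex. 1 - (cmod (z + v))\<^sup>2)"
  have a_C1: "C1_fun (a v)" for v
  proof -
    have "a v = (\<lambda>z. 1 + (-1) * ((Re z + Re v) * (Re z + Re v) + (Im z + Im v) * (Im z + Im v)))"
      unfolding a_def cmod_power2 by (simp add: power2_eq_square fun_eq_iff)
    moreover have "C1_fun \<dots>"
      by (intro C1_fun_add C1_fun_mult C1_fun_const C1_fun_bounded_linear bounded_linear_Re bounded_linear_Im)
    ultimately show ?thesis by simp
  qed
  have a_pos: "0 < a v z \<longleftrightarrow> z + v \<in> ball 0 1" for v z
    by (simp add: a_def abs_square_less_1)
  define \<phi> where "\<phi> = (\<lambda>n z. (1 / (1 + e n)) * p n z * (cutoff n (a 0 z) * cutoff n (a v z)))"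
  \<comment> \<open>The radius at which 1 - |z|^2 equals \<open>e n\<close>, the threshold up to
    which \<open>cutoff n\<close> vanishes.\<close>
  define r where "r = (\<lambda>n. sqrt (1 - e n))"
  have r: "r n < 1" "0 \<le> r n" for n using e[of n] by (auto simp: r_def e_def real_sqrt_lt_1_iff)
  define K where "K = (\<lambda>n. cball 0 (r n) \<inter> cball (-v) (r n))"
  have q0: "cutoff n (a v z) = 0" if "r n < cmod (z + v)" for n v z
  proof -
    have "1 - e n = (r n)\<^sup>2" by (simp add: r_def e_def)
    also have "\<dots> < (cmod (z + v))\<^sup>2" using that r by (intro power_strict_mono) auto
    finally show ?thesis by (intro q(3)) (simp add: a_def e_def)
  qed
  have \<phi>0: "\<phi> n z = 0" if "z \<notin> K n" for n z
    using that q0[of n z 0] q0[of n z v] by (force simp: \<phi>_def K_def dist_norm norm_minus_commute add.commute)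
  have KD: "K n \<subseteq> ball 0 1" "(\<lambda>z. z + v) ` K n \<subseteq> ball 0 1" for n
    using r[of n] by (auto simp: K_def dist_norm norm_minus_commute add.commute)
  show thesis
  proof (rule that[of \<phi>])
    show "C1_fun (\<phi> n)" for n
      unfolding \<phi>_def by (intro C1_fun_mult C1_fun_const C1_fun_real_polynomial p q(5) a_C1)
    show "\<bar>\<phi> n z\<bar> \<le> 1" for n z
    proof (cases "z \<in> K n")
      case True
      then have "z \<in> cball 0 1" using KD[of n] by auto
      then have "\<bar>g' n z - p n z\<bar> < e n" by (rule p)
      moreover have "\<bar>g' n z\<bar> \<le> 1" by (auto simp: g'_def)
      ultimately have "\<bar>p n z\<bar> \<le> 1 + e n" by linarith
      then have "\<bar>(1 / (1 + e n)) * p n z\<bar> \<le> 1"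
        using e[of n] by (simp add: abs_mult field_simps)
      moreover have "\<bar>cutoff n (a 0 z) * cutoff n (a v z)\<bar> \<le> 1"
        using q(1,2) by (simp add: abs_mult mult_le_one)
      ultimately show ?thesis
        unfolding \<phi>_def abs_mult[of "1 / (1 + e n) * p n z"] by (intro mult_le_one) auto
    qed (simp add: \<phi>0)
    show "\<exists>K. compact K \<and> K \<subseteq> ball 0 1 \<and> (\<lambda>z. z + v) ` K \<subseteq> ball 0 1 \<and> (\<forall>z. z \<notin> K \<longrightarrow> \<phi> n z = 0)" for n
      using KD[of n] \<phi>0[of _ n] by (intro exI[of _ "K n"]) (auto simp: K_def intro!: compact_Int)
    have "AE z in lebesgue. z \<notin> N"
      using N by (auto simp: negligible_iff_null_sets intro: AE_not_in)
    then have "AE z in lborel. z \<notin> N"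
      by (simp add: AE_completion_iff)
    then show "AE z in lborel. z \<in> ball 0 1 \<and> z + v \<in> ball 0 1 \<longrightarrow> (\<lambda>n. \<phi> n z) \<longlonglongrightarrow> S z"
    proof (eventually_elim, intro impI)
      fix z assume zN: "z \<notin> N" and z: "z \<in> ball 0 1 \<and> z + v \<in> ball 0 1"
      have "(\<lambda>n. g' n z) \<longlonglongrightarrow> max (-1) (min 1 (S z))"
        unfolding g'_def by (intro tendsto_intros lim zN)
      moreover have "max (-1) (min 1 (S z)) = S z" using S1[of z] by auto
      ultimately have g'lim: "(\<lambda>n. g' n z) \<longlonglongrightarrow> S z" by simp
      have "(\<lambda>n. p n z - g' n z) \<longlonglongrightarrow> 0"
      proof (rule Lim_null_comparison[OF _ e0])
        have "\<bar>g' n z - p n z\<bar> < e n" for n using z by (intro p) auto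
        then show "\<forall>\<^sub>F n in sequentially. norm (p n z - g' n z) \<le> e n"
          by (intro always_eventually allI) (simp add: abs_minus_commute less_imp_le)
      qed
      from tendsto_add[OF this g'lim] have plim: "(\<lambda>n. p n z) \<longlonglongrightarrow> S z" by simp
      have "(\<lambda>n. cutoff n (a 0 z)) \<longlonglongrightarrow> 1" "(\<lambda>n. cutoff n (a v z)) \<longlonglongrightarrow> 1"
        using z by (auto intro!: q(4) simp: a_pos)
      then have "(\<lambda>n. \<phi> n z) \<longlonglongrightarrow> (1 / (1 + 0)) * S z * (1 * 1)"
        unfolding \<phi>_def by (intro tendsto_intros plim e0) auto
      then show "(\<lambda>n. \<phi> n z) \<longlonglongrightarrow> S z" by simp
    qed
  qed
qed

section \<open>Translation differences of functions with an integrable weak gradient\<close>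

lemma integral_lborel_translate:
  fixes f :: "'a::euclidean_space \<Rightarrow> real"
  assumes [measurable]: "f \<in> borel_measurable borel"
  shows "(\<integral>x. f (x + c) \<partial>lborel) = (\<integral>x. f x \<partial>lborel)"
  by (subst lborel_distr_translate[of c, symmetric], subst integral_distr) auto

text \<open>The translation is moved from f to \<phi>, and \<phi>(y - v) - \<phi>(y) is the integral
  over \<tau> in [0, 1] of minus the derivative of \<phi> at y - \<tau> v in direction v. For each
  \<tau> the translated \<phi> is a test function, so the weak gradient and Cauchy-Schwarz bound the
  inner integral.\<close>

lemma translation_diff_tested_le:
  fixes f g1 g2 \<phi> :: "complex \<Rightarrow> real" and v :: complex
  defines "G \<equiv> \<lambda>z. indicator (ball 0 1) z * sqrt ((g1 z)\<^sup>2 + (g2 z)\<^sup>2)"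
  assumes f [measurable]: "f \<in> borel_measurable borel" and bnd: "\<And>z. \<bar>f z\<bar> \<le> M"
    and g [measurable]: "g1 \<in> borel_measurable borel" "g2 \<in> borel_measurable borel"
    and G: "integrable lborel G"
    and weak: "\<And>\<phi>. test_fun_B1 \<phi> \<Longrightarrow>
        (LINT x:ball 0 1|lborel. f x * frechet_derivative \<phi> (at x) 1) = - (LINT x:ball 0 1|lborel. g1 x * \<phi> x) \<and>
        (LINT x:ball 0 1|lborel. f x * frechet_derivative \<phi> (at x) \<i>) = - (LINT x:ball 0 1|lborel. g2 x * \<phi> x)"
    and \<phi>: "C1_fun \<phi>" "\<And>z. \<bar>\<phi> z\<bar> \<le> 1"
    and K: "compact K" "K \<subseteq> ball 0 1" "(\<lambda>z. z + v) ` K \<subseteq> ball 0 1" "\<And>z. z \<notin> K \<Longrightarrow> \<phi> z = 0"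
  shows "(\<integral>z. indicator (ball 0 1) z * indicator (ball 0 1) (z + v) * ((f (z + v) - f z) * \<phi> z) \<partial>lborel)
    \<le> cmod v * (\<integral>z. G z \<partial>lborel)"
proof -
  let ?D = "ball 0 1 :: complex set"
  have [measurable]: "ball x r \<in> sets borel" for x :: complex and r by simp
  have M: "0 \<le> M" using bnd[of 0] by linarith
  obtain \<phi>' where \<phi>': "\<And>x. (\<phi> has_derivative \<phi>' x) (at x)" "\<And>w. continuous_on UNIV (\<lambda>x. \<phi>' x w)"
    using \<phi>(1) unfolding C1_fun_def by metis
  have [measurable]: "\<phi> \<in> borel_measurable borel" "(\<lambda>x. \<phi>' x w) \<in> borel_measurable borel" for w
    using C1_fun_continuous[OF \<phi>(1)] \<phi>'(2) by (auto intro: borel_measurable_continuous_onI)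
  have \<phi>'0: "\<phi>' z w = 0" if "z \<notin> K" for z w
  proof -
    have "(\<phi> has_derivative (\<lambda>_. 0)) (at z)"
      by (rule has_derivative_transform_within_open[of "\<lambda>_. 0" _ _ _ "- K"])
         (use that K compact_imp_closed[OF K(1)] in \<open>auto intro: open_Compl\<close>)
    then show ?thesis
      using has_derivative_unique[OF \<phi>'(1)] by metis
  qed
  have "\<exists>C\<ge>0. \<forall>z. \<bar>\<phi>' z w\<bar> \<le> C" for w
  proof -
    have "bounded ((\<lambda>x. \<phi>' x w) ` K)"
      using compact_continuous_image[OF continuous_on_subset[OF \<phi>'(2)] K(1)] compact_imp_bounded by blast
    then obtain C where "\<forall>z\<in>K. \<bar>\<phi>' z w\<bar> \<le> C" by (auto simp: bounded_iff)
    then have "\<bar>\<phi>' z w\<bar> \<le> max 0 C" for z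
      by (cases "z \<in> K") (auto simp: \<phi>'0 le_max_iff_disj)
    then show ?thesis
      by (intro exI[of _ "max 0 C"]) auto
  qed
  then obtain C where C: "\<And>w. 0 \<le> C w" "\<And>z w. \<bar>\<phi>' z w\<bar> \<le> C w" by metis
  \<comment> \<open>K and its translate by v lie in the convex disk, hence so do all intermediate
    translates; this keeps the translated test functions supported in the disk.\<close>
  have convK: "z + of_real \<tau> * v \<in> ?D" if "z \<in> K" "0 \<le> \<tau>" "\<tau> \<le> 1" for z \<tau>
  proof -
    have "z \<in> ?D" "z + v \<in> ?D" using K that by auto
    then have "(1 - \<tau>) *\<^sub>R z + \<tau> *\<^sub>R (z + v) \<in> ?D"
      using that by (intro convexD_alt[OF convex_ball]) auto
    then show ?thesis by (simp add: scaleR_conv_of_real algebra_simps)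
  qed
  have comp: "Re v * g1 z + Im v * g2 z \<le> cmod v * sqrt ((g1 z)\<^sup>2 + (g2 z)\<^sup>2)"
    "- (Re v * g1 z + Im v * g2 z) \<le> cmod v * sqrt ((g1 z)\<^sup>2 + (g2 z)\<^sup>2)" for z
    using Cauchy_Schwarz_ineq2[of v "Complex (g1 z) (g2 z)"] by (auto simp: inner_complex_def cmod_def)
  have inner: "\<bar>\<integral>y. indicator ?D y * f y * \<phi>' (y - of_real \<tau> * v) v \<partial>lborel\<bar> \<le> cmod v * (\<integral>z. G z \<partial>lborel)"
    if \<tau>: "0 \<le> \<tau>" "\<tau> \<le> 1" for \<tau>
  proof -
    define \<phi>\<tau> where "\<phi>\<tau> = (\<lambda>y. \<phi> (y - of_real \<tau> * v))"
    have \<phi>\<tau>1: "\<bar>\<phi>\<tau> z\<bar> \<le> 1" for z by (simp add: \<phi>\<tau>_def \<phi>)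
    have [measurable]: "\<phi>\<tau> \<in> borel_measurable borel" unfolding \<phi>\<tau>_def by measurable
    have der: "(\<phi>\<tau> has_derivative \<phi>' (y - of_real \<tau> * v)) (at y)" for y
    proof -
      have "((\<lambda>y. y - of_real \<tau> * v) has_derivative (\<lambda>w. w)) (at y)"
        by (auto intro!: derivative_eq_intros)
      from has_derivative_compose[OF this \<phi>'(1)] show ?thesis by (simp add: \<phi>\<tau>_def)
    qed
    have "C1_fun \<phi>\<tau>"
      unfolding C1_fun_def using der
      by (intro exI[of _ "\<lambda>y. \<phi>' (y - of_real \<tau> * v)"])
         (auto intro!: continuous_on_compose2[OF \<phi>'(2)] continuous_intros)
    then have "test_fun_B1 \<phi>\<tau>"
    proof (rule test_fun_B1I)
      show "compact ((\<lambda>z. z + of_real \<tau> * v) ` K)"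
        by (intro compact_continuous_image continuous_intros K)
      show "(\<lambda>z. z + of_real \<tau> * v) ` K \<subseteq> ball 0 1" using convK \<tau> by blast
      show "\<phi>\<tau> x = 0" if "x \<notin> (\<lambda>z. z + of_real \<tau> * v) ` K" for x
      proof -
        have "x - of_real \<tau> * v \<notin> K" using that by (metis diff_add_cancel imageI)
        then show ?thesis by (simp add: \<phi>\<tau>_def K)
      qed
    qed
    from weak[OF this] have w: "(\<integral>y. indicator ?D y * (f y * \<phi>' (y - of_real \<tau> * v) 1) \<partial>lborel) = - (\<integral>y. indicator ?D y * (g1 y * \<phi>\<tau> y) \<partial>lborel)"
      "(\<integral>y. indicator ?D y * (f y * \<phi>' (y - of_real \<tau> * v) \<i>) \<partial>lborel) = - (\<integral>y. indicator ?D y * (g2 y * \<phi>\<tau> y) \<partial>lborel)"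
      by (simp_all add: set_lebesgue_integral_def frechet_derivative_at[OF der, symmetric])
    \<comment> \<open>The weak gradient is tested in the directions 1 and \<i> only; linearity of
      the derivative gives the direction v.\<close>
    have lin: "\<phi>' z v = Re v * \<phi>' z 1 + Im v * \<phi>' z \<i>" for z
    proof -
      have l: "linear (\<phi>' z)" using \<phi>'(1)[of z] by (simp add: has_derivative_def bounded_linear.linear)
      have "v = Re v *\<^sub>R 1 + Im v *\<^sub>R \<i>" by (simp add: complex_eq_iff)
      then have "\<phi>' z v = \<phi>' z (Re v *\<^sub>R 1 + Im v *\<^sub>R \<i>)" by simp
      also have "\<dots> = Re v * \<phi>' z 1 + Im v * \<phi>' z \<i>"
        using l by (simp only: linear_add linear_scale) simp
      finally show ?thesis .
    qed
    have int_f: "integrable lborel (\<lambda>y. indicator ?D y * (f y * \<phi>' (y - of_real \<tau> * v) w))" for w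
    proof (rule integrable_bounded_on_ball[where M = "M * C w" and x = 0 and r = 1])
      show "\<bar>indicator ?D y * (f y * \<phi>' (y - of_real \<tau> * v) w)\<bar> \<le> M * C w * indicator ?D y" for y
        using mult_mono[OF bnd C(2) M] by (auto simp: abs_mult split: split_indicator)
    qed measurable
    have int_g: "integrable lborel (\<lambda>y. indicator ?D y * (g1 y * \<phi>\<tau> y))" "integrable lborel (\<lambda>y. indicator ?D y * (g2 y * \<phi>\<tau> y))"
    proof -
      have *: "\<bar>a * \<phi>\<tau> y\<bar> \<le> sqrt (a\<^sup>2 + b\<^sup>2)" "\<bar>a * \<phi>\<tau> y\<bar> \<le> sqrt (b\<^sup>2 + a\<^sup>2)" for a b y
      proof -
        have "\<bar>a * \<phi>\<tau> y\<bar> \<le> \<bar>a\<bar>" using \<phi>\<tau>1[of y] by (simp add: abs_mult mult_left_le)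
        also have "\<bar>a\<bar> \<le> sqrt (a\<^sup>2 + b\<^sup>2)" by (rule real_le_rsqrt) simp
        finally show "\<bar>a * \<phi>\<tau> y\<bar> \<le> sqrt (a\<^sup>2 + b\<^sup>2)" "\<bar>a * \<phi>\<tau> y\<bar> \<le> sqrt (b\<^sup>2 + a\<^sup>2)" by (simp_all add: add.commute)
      qed
      show "integrable lborel (\<lambda>y. indicator ?D y * (g1 y * \<phi>\<tau> y))" "integrable lborel (\<lambda>y. indicator ?D y * (g2 y * \<phi>\<tau> y))"
        by (rule Bochner_Integration.integrable_bound[OF G];
            use * in \<open>auto simp: G_def intro!: AE_I2 split: split_indicator\<close>)+
    qed
    have "(\<integral>y. indicator ?D y * f y * \<phi>' (y - of_real \<tau> * v) v \<partial>lborel) =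
        (\<integral>y. Re v * (indicator ?D y * (f y * \<phi>' (y - of_real \<tau> * v) 1)) + Im v * (indicator ?D y * (f y * \<phi>' (y - of_real \<tau> * v) \<i>)) \<partial>lborel)"
      by (intro Bochner_Integration.integral_cong) (auto simp: lin[of "_ - _"] algebra_simps)
    also have "\<dots> = Re v * (- (\<integral>y. indicator ?D y * (g1 y * \<phi>\<tau> y) \<partial>lborel)) + Im v * (- (\<integral>y. indicator ?D y * (g2 y * \<phi>\<tau> y) \<partial>lborel))"
      using int_f by (subst Bochner_Integration.integral_add) (auto simp: w)
    also have "\<dots> = - (\<integral>y. Re v * (indicator ?D y * (g1 y * \<phi>\<tau> y)) + Im v * (indicator ?D y * (g2 y * \<phi>\<tau> y)) \<partial>lborel)"
      using int_g by (subst Bochner_Integration.integral_add) auto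
    also have "\<bar>\<dots>\<bar> \<le> (\<integral>y. \<bar>Re v * (indicator ?D y * (g1 y * \<phi>\<tau> y)) + Im v * (indicator ?D y * (g2 y * \<phi>\<tau> y))\<bar> \<partial>lborel)"
      unfolding abs_minus_cancel by (rule integral_abs_bound)
    also have "\<dots> \<le> (\<integral>y. cmod v * G y \<partial>lborel)"
    proof (rule integral_mono)
      show "integrable lborel (\<lambda>y. \<bar>Re v * (indicator ?D y * (g1 y * \<phi>\<tau> y)) + Im v * (indicator ?D y * (g2 y * \<phi>\<tau> y))\<bar>)"
        by (intro integrable_abs Bochner_Integration.integrable_add integrable_mult_right int_g)
      show "integrable lborel (\<lambda>y. cmod v * G y)" by (intro integrable_mult_right G)
      fix y
      have "\<bar>Re v * (g1 y * \<phi>\<tau> y) + Im v * (g2 y * \<phi>\<tau> y)\<bar> = \<bar>Re v * g1 y + Im v * g2 y\<bar> * \<bar>\<phi>\<tau> y\<bar>"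
        unfolding abs_mult[symmetric] by (simp add: algebra_simps)
      also have "\<dots> \<le> \<bar>Re v * g1 y + Im v * g2 y\<bar>" using \<phi>\<tau>1[of y] by (simp add: mult_left_le)
      also have "\<dots> \<le> cmod v * sqrt ((g1 y)\<^sup>2 + (g2 y)\<^sup>2)" using comp[of y] by linarith
      finally show "\<bar>Re v * (indicator ?D y * (g1 y * \<phi>\<tau> y)) + Im v * (indicator ?D y * (g2 y * \<phi>\<tau> y))\<bar> \<le> cmod v * G y"
        by (auto simp: G_def split: split_indicator)
    qed
    finally show ?thesis by simp
  qed
  define p where "p = (\<lambda>\<tau> y. indicator {0..1} \<tau> * (indicator ?D y * f y * \<phi>' (y - of_real \<tau> * v) v))"
  have [measurable]: "case_prod p \<in> borel_measurable (borel \<Otimes>\<^sub>M borel)" unfolding p_def by measurable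
  have p_int: "integrable (lborel \<Otimes>\<^sub>M lborel) (case_prod p)"
  proof (rule integrableI_bounded_set[where A = "{0..1} \<times> ?D" and B = "M * C v"])
    show "emeasure (lborel \<Otimes>\<^sub>M lborel) ({0..1::real} \<times> ?D) < \<infinity>"
      using emeasure_bounded_finite[OF bounded_ball, of "0::complex" 1]
      by (subst lborel.emeasure_pair_measure_Times) (auto simp: ennreal_mult_less_top)
    show "AE x in lborel \<Otimes>\<^sub>M lborel. x \<in> {0..1} \<times> ?D \<longrightarrow> norm (case_prod p x) \<le> M * C v"
      using mult_mono[OF bnd C(2) M] by (intro AE_I2) (auto simp: p_def abs_mult)
    show "AE x in lborel \<Otimes>\<^sub>M lborel. x \<notin> {0..1} \<times> ?D \<longrightarrow> case_prod p x = 0"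
      by (intro AE_I2) (auto simp: p_def indicator_def split: if_splits)
  qed auto
  have FTC: "(\<integral>\<tau>. p \<tau> y \<partial>lborel) = - (indicator ?D y * f y * (\<phi> (y - v) - \<phi> y))" for y
  proof -
    have "(\<integral>\<tau>. - \<phi>' (y - of_real \<tau> * v) v * indicator {0..1} \<tau> \<partial>lborel) = \<phi> (y - of_real 1 * v) - \<phi> (y - of_real 0 * v)"
    proof (rule integral_FTC_Icc_real)
      fix \<tau> :: real
      have "((\<lambda>\<tau>. y - of_real \<tau> * v) has_derivative (\<lambda>h. - (of_real h * v))) (at \<tau>)"
        by (auto intro!: derivative_eq_intros)
      from has_derivative_compose[OF this \<phi>'(1)]
      have "((\<lambda>\<tau>. \<phi> (y - of_real \<tau> * v)) has_derivative (\<lambda>h. \<phi>' (y - of_real \<tau> * v) (- (of_real h * v)))) (at \<tau>)" .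
      moreover have "\<phi>' z (- (of_real h * v)) = - \<phi>' z v * h" for z h
      proof -
        have l: "linear (\<phi>' z)" using \<phi>'(1)[of z] by (simp add: has_derivative_def bounded_linear.linear)
        have "- (of_real h * v) = (- h) *\<^sub>R v" by (simp add: scaleR_conv_of_real)
        then show ?thesis using linear_scale[OF l, of "- h" v] by simp
      qed
      ultimately show "((\<lambda>\<tau>. \<phi> (y - of_real \<tau> * v)) has_real_derivative - \<phi>' (y - of_real \<tau> * v) v) (at \<tau>)"
        by (simp only: has_field_derivative_def)
      show "isCont (\<lambda>\<tau>. - \<phi>' (y - of_real \<tau> * v) v) \<tau>"
      proof -
        have "continuous_on UNIV (\<lambda>\<tau>. - \<phi>' (y - of_real \<tau> * v) v)"
          by (intro continuous_intros continuous_on_compose2[OF \<phi>'(2)[of v]]) auto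
        then show ?thesis by (simp add: continuous_on_eq_continuous_at)
      qed
    qed simp
    then have "(\<integral>\<tau>. \<phi>' (y - of_real \<tau> * v) v * indicator {0..1} \<tau> \<partial>lborel) = - (\<phi> (y - v) - \<phi> y)"
      by simp
    moreover have "(\<integral>\<tau>. p \<tau> y \<partial>lborel) = (\<integral>\<tau>. (indicator ?D y * f y) * (\<phi>' (y - of_real \<tau> * v) v * indicator {0..1} \<tau>) \<partial>lborel)"
      by (simp add: p_def mult_ac)
    ultimately show ?thesis by (simp add: right_diff_distrib)
  qed
  have int1: "integrable lborel (\<lambda>y. indicator ?D y * f y * \<phi> (y - v))"
  proof (rule integrable_bounded_on_ball[where M = M and x = 0 and r = 1])
    show "\<bar>indicator ?D y * f y * \<phi> (y - v)\<bar> \<le> M * indicator ?D y" for y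
      using mult_mono[OF bnd[of y] \<phi>(2)[of "y - v"] M] by (auto simp: abs_mult split: split_indicator)
  qed measurable
  have int2: "integrable lborel (\<lambda>y. indicator ?D y * f y * \<phi> y)"
  proof (rule integrable_bounded_on_ball[where M = M and x = 0 and r = 1])
    show "\<bar>indicator ?D y * f y * \<phi> y\<bar> \<le> M * indicator ?D y" for y
      using mult_mono[OF bnd[of y] \<phi>(2)[of y] M] by (auto simp: abs_mult split: split_indicator)
  qed measurable
  have tr: "(\<integral>z. indicator ?D (z + v) * f (z + v) * \<phi> (z + v - v) \<partial>lborel) = (\<integral>y. indicator ?D y * f y * \<phi> (y - v) \<partial>lborel)"
    by (rule integral_lborel_translate) measurable
  have int3: "integrable lborel (\<lambda>z. indicator ?D (z + v) * f (z + v) * \<phi> (z + v - v))"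
  proof (rule integrable_bounded_on_ball[where M = M and x = "-v" and r = 1])
    show "\<bar>indicator ?D (z + v) * f (z + v) * \<phi> (z + v - v)\<bar> \<le> M * indicator (ball (- v) 1) z" for z
      using mult_mono[OF bnd[of "z + v"] \<phi>(2)[of z] M]
      by (auto simp: abs_mult dist_norm norm_minus_commute add.commute split: split_indicator)
  qed measurable
  \<comment> \<open>Off K everything vanishes and on K both indicators are 1, so the product of
    indicators may be split between the two terms.\<close>
  have "(\<integral>z. indicator ?D z * indicator ?D (z + v) * ((f (z + v) - f z) * \<phi> z) \<partial>lborel) =
      (\<integral>z. indicator ?D (z + v) * f (z + v) * \<phi> (z + v - v) - indicator ?D z * f z * \<phi> z \<partial>lborel)"
  proof (rule Bochner_Integration.integral_cong)
    fix z
    show "indicator ?D z * indicator ?D (z + v) * ((f (z + v) - f z) * \<phi> z) =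
       indicator ?D (z + v) * f (z + v) * \<phi> (z + v - v) - indicator ?D z * f z * \<phi> z"
    proof (cases "z \<in> K")
      case True
      then have "z \<in> ?D" "z + v \<in> ?D" using K by auto
      then show ?thesis by (simp add: algebra_simps del: mem_ball)
    qed (simp add: K)
  qed simp
  also have "\<dots> = (\<integral>y. indicator ?D y * f y * \<phi> (y - v) \<partial>lborel) - (\<integral>y. indicator ?D y * f y * \<phi> y \<partial>lborel)"
    by (simp only: Bochner_Integration.integral_diff[OF int3 int2] tr)
  also have "\<dots> = (\<integral>y. indicator ?D y * f y * \<phi> (y - v) - indicator ?D y * f y * \<phi> y \<partial>lborel)"
    by (rule Bochner_Integration.integral_diff[OF int1 int2, symmetric])
  also have "\<dots> = - (\<integral>y. (\<integral>\<tau>. p \<tau> y \<partial>lborel) \<partial>lborel)"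
    by (simp only: FTC Bochner_Integration.integral_minus minus_minus right_diff_distrib)
  also have "(\<integral>y. (\<integral>\<tau>. p \<tau> y \<partial>lborel) \<partial>lborel) = (\<integral>\<tau>. (\<integral>y. p \<tau> y \<partial>lborel) \<partial>lborel)"
    by (rule lborel_pair.Fubini_integral[OF p_int])
  also have "- \<dots> \<le> \<bar>\<integral>\<tau>. (\<integral>y. p \<tau> y \<partial>lborel) \<partial>lborel\<bar>" by linarith
  also have "\<dots> \<le> (\<integral>\<tau>. \<bar>\<integral>y. p \<tau> y \<partial>lborel\<bar> \<partial>lborel)"
    by (rule integral_abs_bound)
  also have "\<dots> \<le> (\<integral>\<tau>. indicator {0..1::real} \<tau> * (cmod v * (\<integral>z. G z \<partial>lborel)) \<partial>lborel)"
  proof (rule integral_mono)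
    show "integrable lborel (\<lambda>\<tau>. \<bar>\<integral>y. p \<tau> y \<partial>lborel\<bar>)"
      using lborel_pair.integrable_fst[OF p_int] by (intro integrable_abs) simp
    show "\<bar>\<integral>y. p \<tau> y \<partial>lborel\<bar> \<le> indicator {0..1::real} \<tau> * (cmod v * (\<integral>z. G z \<partial>lborel))" for \<tau>
      using inner[of \<tau>] by (auto simp: p_def split: split_indicator)
  qed (intro integrable_mult_left integrable_real_indicator, auto)
  also have "\<dots> = cmod v * (\<integral>z. G z \<partial>lborel)" by simp
  finally show ?thesis .
qed

text \<open>Duality: the L1 norm of the difference is its integral against its own sign. The sign is
  an almost everywhere limit of compactly supported C1 functions bounded by 1, and the bound on f
  provides the dominating function.\<close>

lemma translation_diff_le_weak_gradient:
  fixes f g1 g2 :: "complex \<Rightarrow> real" and v :: complex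
  assumes f [measurable]: "f \<in> borel_measurable borel" and bnd: "\<And>z. \<bar>f z\<bar> \<le> M"
    and g [measurable]: "g1 \<in> borel_measurable borel" "g2 \<in> borel_measurable borel"
    and weak: "\<And>\<phi>. test_fun_B1 \<phi> \<Longrightarrow>
        (LINT x:ball 0 1|lborel. f x * frechet_derivative \<phi> (at x) 1) = - (LINT x:ball 0 1|lborel. g1 x * \<phi> x) \<and>
        (LINT x:ball 0 1|lborel. f x * frechet_derivative \<phi> (at x) \<i>) = - (LINT x:ball 0 1|lborel. g2 x * \<phi> x)"
    and fin: "(\<integral>\<^sup>+x. indicator (ball 0 1) x * ennreal (sqrt ((g1 x)\<^sup>2 + (g2 x)\<^sup>2)) \<partial>lborel) < \<infinity>"
  shows "(\<integral>\<^sup>+z. indicator (ball 0 1) z * indicator (ball 0 1) (z + v) * ennreal \<bar>f (z + v) - f z\<bar> \<partial>lborel)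
    \<le> ennreal (cmod v) * (\<integral>\<^sup>+x. indicator (ball 0 1) x * ennreal (sqrt ((g1 x)\<^sup>2 + (g2 x)\<^sup>2)) \<partial>lborel)"
proof -
  let ?D = "ball 0 1 :: complex set"
  have [measurable]: "ball x r \<in> sets borel" for x :: complex and r by simp
  have M: "0 \<le> M" using bnd[of 0] by linarith
  define G where "G = (\<lambda>z. indicator ?D z * sqrt ((g1 z)\<^sup>2 + (g2 z)\<^sup>2))"
  have [measurable]: "G \<in> borel_measurable borel" unfolding G_def by measurable
  have G0: "0 \<le> G z" for z by (simp add: G_def)
  have Gnn: "(\<integral>\<^sup>+x. indicator ?D x * ennreal (sqrt ((g1 x)\<^sup>2 + (g2 x)\<^sup>2)) \<partial>lborel) = (\<integral>\<^sup>+x. ennreal (G x) \<partial>lborel)"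
    by (intro nn_integral_cong) (auto simp: G_def split: split_indicator)
  have G: "integrable lborel G"
    using fin unfolding Gnn by (intro integrableI_nonneg) (auto simp: G0)
  define U where "U = (\<lambda>z. indicator ?D z * indicator ?D (z + v) :: real)"
  have [measurable]: "U \<in> borel_measurable borel" unfolding U_def by measurable
  define S where "S = (\<lambda>z. sgn (f (z + v) - f z))"
  have S_meas: "S \<in> borel_measurable borel" unfolding S_def by measurable
  have S1: "\<bar>S z\<bar> \<le> 1" for z by (auto simp: S_def sgn_if)
  obtain \<phi> where \<phi>: "\<And>n::nat. C1_fun (\<phi> n)" "\<And>n z. \<bar>\<phi> n z\<bar> \<le> 1"
    "\<And>n. \<exists>K. compact K \<and> K \<subseteq> ball 0 1 \<and> (\<lambda>z. z + v) ` K \<subseteq> ball 0 1 \<and> (\<forall>z. z \<notin> K \<longrightarrow> \<phi> n z = 0)"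
    "AE z in lborel. z \<in> ball 0 1 \<and> z + v \<in> ball 0 1 \<longrightarrow> (\<lambda>n. \<phi> n z) \<longlonglongrightarrow> S z"
    using test_functions_approximate[OF S_meas S1, of v] by blast
  have [measurable]: "\<phi> n \<in> borel_measurable borel" for n
    using C1_fun_continuous[OF \<phi>(1)] by (rule borel_measurable_continuous_onI)
  have le: "(\<integral>z. U z * ((f (z + v) - f z) * \<phi> n z) \<partial>lborel) \<le> cmod v * (\<integral>z. G z \<partial>lborel)" for n
  proof -
    obtain K where "compact K" "K \<subseteq> ball 0 1" "(\<lambda>z. z + v) ` K \<subseteq> ball 0 1" "\<And>z. z \<notin> K \<Longrightarrow> \<phi> n z = 0"
      using \<phi>(3)[of n] by blast
    then show ?thesis
      unfolding U_def G_def
      by (intro translation_diff_tested_le[OF f bnd g G[unfolded G_def] weak \<phi>(1,2)]) auto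
  qed
  have dif: "\<bar>f (z + v) - f z\<bar> \<le> 2 * M" for z
    using bnd[of z] bnd[of "z + v"] by linarith
  have lim: "(\<lambda>n. \<integral>z. U z * ((f (z + v) - f z) * \<phi> n z) \<partial>lborel) \<longlonglongrightarrow> (\<integral>z. U z * \<bar>f (z + v) - f z\<bar> \<partial>lborel)"
  proof (rule integral_dominated_convergence[where w = "\<lambda>z. (2 * M) * indicator ?D z"])
    show "AE z in lborel. (\<lambda>n. U z * ((f (z + v) - f z) * \<phi> n z)) \<longlonglongrightarrow> U z * \<bar>f (z + v) - f z\<bar>"
      using \<phi>(4)
    proof eventually_elim
      case (elim z)
      show ?case
      proof (cases "z \<in> ?D \<and> z + v \<in> ?D")
        case True
        then have "(\<lambda>n. U z * ((f (z + v) - f z) * \<phi> n z)) \<longlonglongrightarrow> U z * ((f (z + v) - f z) * S z)"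
          using elim by (intro tendsto_intros) auto
        moreover have "(f (z + v) - f z) * S z = \<bar>f (z + v) - f z\<bar>"
          by (simp add: S_def abs_sgn)
        ultimately show ?thesis by simp
      qed (auto simp: U_def)
    qed
    show "AE z in lborel. norm (U z * ((f (z + v) - f z) * \<phi> n z)) \<le> (2 * M) * indicator ?D z" for n
    proof (rule AE_I2)
      fix z
      have "\<bar>f (z + v) - f z\<bar> * \<bar>\<phi> n z\<bar> \<le> (2 * M) * 1"
        using M by (intro mult_mono dif \<phi>) auto
      then show "norm (U z * ((f (z + v) - f z) * \<phi> n z)) \<le> (2 * M) * indicator ?D z"
        using M by (auto simp: U_def abs_mult split: split_indicator)
    qed
  qed (auto intro!: integrable_mult_right)
  then have real_le: "(\<integral>z. U z * \<bar>f (z + v) - f z\<bar> \<partial>lborel) \<le> cmod v * (\<integral>z. G z \<partial>lborel)"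
    by (rule LIMSEQ_le_const2) (use le in auto)
  have U_int: "integrable lborel (\<lambda>z. U z * \<bar>f (z + v) - f z\<bar>)"
    by (rule integrable_bounded_on_ball[where M = "2 * M" and x = 0 and r = 1])
       (use dif M in \<open>auto simp: U_def split: split_indicator\<close>)
  have "(\<integral>\<^sup>+z. indicator ?D z * indicator ?D (z + v) * ennreal \<bar>f (z + v) - f z\<bar> \<partial>lborel) =
      (\<integral>\<^sup>+z. ennreal (U z * \<bar>f (z + v) - f z\<bar>) \<partial>lborel)"
    by (intro nn_integral_cong) (auto simp: U_def split: split_indicator)
  also have "\<dots> = ennreal (\<integral>z. U z * \<bar>f (z + v) - f z\<bar> \<partial>lborel)"
    by (rule nn_integral_eq_integral[OF U_int]) (auto simp: U_def)
  also have "\<dots> \<le> ennreal (cmod v * (\<integral>z. G z \<partial>lborel))"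
    by (rule ennreal_leI[OF real_le])
  also have "\<dots> = ennreal (cmod v) * (\<integral>\<^sup>+x. ennreal (G x) \<partial>lborel)"
    using G0 by (subst nn_integral_eq_integral[OF G]) (auto simp: ennreal_mult)
  finally show ?thesis unfolding Gnn .
qed

subsection \<open>Mixing scale estimates\<close>

lemma Linf_B1_nonneg:
  assumes "\<exists>M. AE x in lborel. \<bar>f x\<bar> \<le> M"
  shows "0 \<le> Linf_B1 f"
proof -
  obtain M where M: "AE x in lborel. \<bar>f x\<bar> \<le> M" using assms by blast
  have "AE x in lborel. x \<in> ball 0 1 \<longrightarrow> \<bar>f x\<bar> \<le> max 0 M"
    using M by eventually_elim auto
  then show ?thesis
    unfolding Linf_B1_def by (intro cInf_greatest) (auto intro!: exI[of _ "max 0 M"])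
qed

text \<open>The infimum is attained: the bound enlarged by 1/(n + 1) holds off a null set for each
  n, and countably many null sets may be discarded at once.\<close>

lemma AE_le_Linf_B1:
  assumes "\<exists>M. AE x in lborel. \<bar>f x\<bar> \<le> M"
  shows "AE x in lborel. x \<in> ball 0 1 \<longrightarrow> \<bar>f x\<bar> \<le> Linf_B1 f"
proof -
  let ?X = "{M. 0 \<le> M \<and> (AE x in lborel. x \<in> ball 0 1 \<longrightarrow> \<bar>f x\<bar> \<le> M)}"
  obtain M where M: "AE x in lborel. \<bar>f x\<bar> \<le> M" using assms by blast
  have "AE x in lborel. x \<in> ball 0 1 \<longrightarrow> \<bar>f x\<bar> \<le> max 0 M"
    using M by eventually_elim auto
  then have ne: "?X \<noteq> {}" by (auto intro!: exI[of _ "max 0 M"])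
  have "AE x in lborel. x \<in> ball 0 1 \<longrightarrow> \<bar>f x\<bar> \<le> Linf_B1 f + 1 / real (Suc n)" for n
  proof -
    have "Inf ?X < Linf_B1 f + 1 / real (Suc n)" by (simp add: Linf_B1_def)
    from cInf_lessD[OF ne this] obtain M' where "M' < Linf_B1 f + 1 / real (Suc n)"
      "AE x in lborel. x \<in> ball 0 1 \<longrightarrow> \<bar>f x\<bar> \<le> M'" by auto
    from this(2) show ?thesis
      by eventually_elim (use \<open>M' < _\<close> in auto)
  qed
  then have "AE x in lborel. \<forall>n. x \<in> ball 0 1 \<longrightarrow> \<bar>f x\<bar> \<le> Linf_B1 f + 1 / real (Suc n)"
    unfolding AE_all_countable by (rule allI)
  then show ?thesis
  proof eventually_elim
    case (elim x)
    show ?case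
    proof (rule impI, rule field_le_epsilon)
      fix e :: real assume "x \<in> ball 0 1" "0 < e"
      obtain n where n: "1 / real (Suc n) < e"
        by (rule nat_approx_posE[OF \<open>0 < e\<close>])
      have "\<bar>f x\<bar> \<le> Linf_B1 f + 1 / real (Suc n)" using elim \<open>x \<in> ball 0 1\<close> by blast
      then show "\<bar>f x\<bar> \<le> Linf_B1 f + e" using n by linarith
    qed
  qed
qed

text \<open>The twist preserves moduli and null sets, so the threshold in the mixing scale is the
  same at all times.\<close>

lemma Linf_B1_sol:
  assumes [measurable]: "\<rho> \<in> borel_measurable borel"
  shows "Linf_B1 (sol \<rho> t) = Linf_B1 \<rho>"
proof -
  let ?T = "\<lambda>z. z * cis (2 * pi * t * cmod z)"
  have "(AE x in lborel. x \<in> ball 0 1 \<longrightarrow> \<bar>sol \<rho> t x\<bar> \<le> M) \<longleftrightarrow>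
      (AE x in lborel. x \<in> ball 0 1 \<longrightarrow> \<bar>\<rho> x\<bar> \<le> M)" for M
  proof -
    have [measurable]: "ball x r \<in> sets borel" for x :: complex and r by simp
    have "(AE x in lborel. x \<in> ball 0 1 \<longrightarrow> \<bar>sol \<rho> t x\<bar> \<le> M) \<longleftrightarrow>
        (AE x in lborel. ?T x \<in> ball 0 1 \<longrightarrow> \<bar>\<rho> (?T x)\<bar> \<le> M)"
      by (simp add: sol_def norm_mult)
    also have "\<dots> \<longleftrightarrow> (AE x in distr lborel borel ?T. x \<in> ball 0 1 \<longrightarrow> \<bar>\<rho> x\<bar> \<le> M)"
      by (rule AE_distr_iff[symmetric]) measurable
    also have "distr lborel borel ?T = lborel"
      by (rule lborel_distr_twist) measurable
    finally show ?thesis .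
  qed
  then show ?thesis by (simp only: Linf_B1_def)
qed

lemma mix_scale_leI:
  assumes "0 < \<epsilon>"
    "\<And>x. \<bar>(LINT y:ball x \<epsilon>|lborel. indicator (cball 0 1) y * f y) / measure lborel (ball x \<epsilon>)\<bar> \<le> \<kappa> * Linf_B1 f"
  shows "mix_scale \<kappa> f \<le> \<epsilon>"
  unfolding mix_scale_def by (rule cInf_lower) (use assms in \<open>auto intro!: bdd_belowI[of _ 0]\<close>)

text \<open>The polar formula for the set where P fails gives a zero integral with the positive
  weight r, so almost every circle meets this set in zero arc length.\<close>

lemma AE_polar:
  assumes "AE z in lborel. P z" and [measurable]: "Measurable.pred borel P"
  shows "AE r in lborel. 0 < r \<longrightarrow> (AE u in circle_measure. P (of_real r * u))"
proof -
  have [measurable]: "{z. \<not> P z} \<in> sets borel" by measurable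
  have "(\<integral>\<^sup>+z. indicator {z. \<not> P z} z \<partial>lborel) = 0"
    using assms(1) by (subst nn_integral_0_iff_AE) (auto simp: indicator_def)
  then have "(\<integral>\<^sup>+r. indicator {0<..} r * ennreal r *
      (\<integral>\<^sup>+u. indicator {z. \<not> P z} (of_real r * u) \<partial>circle_measure) \<partial>lborel) = 0"
    by (subst (asm) nn_integral_polar) auto
  then have "AE r in lborel. indicator {0<..} r * ennreal r *
      (\<integral>\<^sup>+u. indicator {z. \<not> P z} (of_real r * u) \<partial>circle_measure) = 0"
    by (subst (asm) nn_integral_0_iff_AE) auto
  then show ?thesis
  proof eventually_elim
    case (elim r)
    show ?case
    proof
      assume "0 < r"
      with elim have "(\<integral>\<^sup>+u. indicator {z. \<not> P z} (of_real r * u) \<partial>circle_measure) = 0"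
        by (auto simp: ennreal_eq_0_iff)
      then have "AE u in circle_measure. indicator {z. \<not> P z} (of_real r * u) = (0::ennreal)"
        by (subst (asm) nn_integral_0_iff_AE) auto
      then show "AE u in circle_measure. P (of_real r * u)"
        by eventually_elim (auto simp: indicator_def split: if_splits)
    qed
  qed
qed

lemma integral_circle_measure:
  fixes f :: "complex \<Rightarrow> real"
  assumes [measurable]: "f \<in> borel_measurable borel"
  shows "(\<integral>u. f u \<partial>circle_measure) = (LBINT \<theta>=0..2*pi. f (cis \<theta>))"
proof -
  have "(\<integral>u. f u \<partial>circle_measure) = (\<integral>\<theta>. f (cis \<theta>) \<partial>density lborel (indicator {0..<2*pi}))"
    unfolding circle_measure_def by (subst integral_distr) auto
  also have "(indicator {0..<2*pi} :: real \<Rightarrow> ennreal) = (\<lambda>x. ennreal (indicator {0..<2*pi} x))"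
    by (auto simp: ennreal_indicator)
  also have "(\<integral>\<theta>. f (cis \<theta>) \<partial>density lborel \<dots>) = (\<integral>\<theta>. indicator {0..<2*pi} \<theta> *\<^sub>R f (cis \<theta>) \<partial>lborel)"
    by (subst integral_density) auto
  \<comment> \<open>The interval integral is over the open interval, so the endpoint 0 is dropped as
    a null set.\<close>
  also have "\<dots> = (\<integral>\<theta>. indicator {0<..<2*pi} \<theta> *\<^sub>R f (cis \<theta>) \<partial>lborel)"
    by (rule integral_cong_AE; (measurable)?)
       (use AE_lborel_singleton[of "0::real"] in \<open>eventually_elim, auto split: split_indicator\<close>)
  also have "\<dots> = (LBINT \<theta>=0..2*pi. f (cis \<theta>))"
    by (simp add: interval_lebesgue_integral_def einterval_eq set_lebesgue_integral_def zero_ereal_def)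
  finally show ?thesis .
qed

text \<open>Changing \<rho> on a planar null set affects almost no circle. For r < 1 the arc-length
  factor r is divided out; for r \<ge> 1 the function h vanishes on the circle.\<close>

lemma circle_mean_transfer:
  fixes \<rho> h :: "complex \<Rightarrow> real"
  assumes [measurable]: "\<rho> \<in> borel_measurable borel" "h \<in> borel_measurable borel"
    and eq: "AE z in lborel. cmod z < 1 \<longrightarrow> \<rho> z = h z" and supp: "\<And>z. 1 \<le> cmod z \<Longrightarrow> h z = 0"
    and mean: "AE r::real in lborel. 0 < r \<longrightarrow> (LBINT \<theta>=0..2*pi. \<rho> (of_real r * cis \<theta>) * r) = 0"
  shows "AE r in lborel. 0 < r \<longrightarrow> (\<integral>u. h (of_real r * u) \<partial>circle_measure) = 0"
proof -
  have "AE r in lborel. 0 < r \<longrightarrow> (AE u in circle_measure. cmod (of_real r * u) < 1 \<longrightarrow> \<rho> (of_real r * u) = h (of_real r * u))"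
    by (rule AE_polar[OF eq]) measurable
  with mean show ?thesis
  proof (eventually_elim, intro impI)
    fix r :: real
    assume *: "0 < r \<longrightarrow> (LBINT \<theta>=0..2*pi. \<rho> (of_real r * cis \<theta>) * r) = 0"
      "0 < r \<longrightarrow> (AE u in circle_measure. cmod (of_real r * u) < 1 \<longrightarrow> \<rho> (of_real r * u) = h (of_real r * u))"
      and r: "0 < r"
    have unit: "AE u in circle_measure. cmod u = 1"
      by (rule AE_circle_measure) auto
    show "(\<integral>u. h (of_real r * u) \<partial>circle_measure) = 0"
    proof (cases "r < 1")
      case True
      have "(\<integral>u. h (of_real r * u) \<partial>circle_measure) = (\<integral>u. \<rho> (of_real r * u) \<partial>circle_measure)"
      proof (rule integral_cong_AE)
        have "AE u in circle_measure. cmod (of_real r * u) < 1 \<longrightarrow> \<rho> (of_real r * u) = h (of_real r * u)"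
          using * r by blast
        with unit show "AE u in circle_measure. h (of_real r * u) = \<rho> (of_real r * u)"
          by eventually_elim (use True r in \<open>auto simp: norm_mult\<close>)
      qed measurable
      also have "\<dots> * r = (\<integral>u. \<rho> (of_real r * u) * r \<partial>circle_measure)" by simp
      also have "\<dots> = 0"
        using * r by (subst integral_circle_measure) auto
      finally show ?thesis using r by simp
    next
      case False
      show ?thesis
        by (rule integral_eq_zero_AE) (use unit in \<open>eventually_elim, use False r in \<open>auto simp: norm_mult supp\<close>\<close>)
    qed
  qed
qed

text \<open>\<rho> is replaced by a representative h bounded by L everywhere and zero off the open
  disk. \<epsilon> \<ge> 34/(\<kappa> t) makes 17 pi L \<epsilon>/t at most half of \<kappa> L pi
  \<epsilon>^2, and E grants the other half. E is asked for L > 0 only, because h = 0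
  otherwise.\<close>

lemma mix_scale_sol_le:
  fixes \<rho> h :: "complex \<Rightarrow> real" and \<kappa> t \<epsilon> :: real
  defines "L \<equiv> Linf_B1 \<rho>"
  assumes [measurable]: "\<rho> \<in> borel_measurable borel" and h [measurable]: "h \<in> borel_measurable borel"
    and eq: "AE z in lborel. cmod z < 1 \<longrightarrow> \<rho> z = h z"
    and bnd: "\<And>z. \<bar>h z\<bar> \<le> L" and supp: "\<And>z. 1 \<le> cmod z \<Longrightarrow> h z = 0"
    and mean: "AE r::real in lborel. 0 < r \<longrightarrow> (LBINT \<theta>=0..2*pi. \<rho> (of_real r * cis \<theta>) * r) = 0"
    and \<kappa>: "0 < \<kappa>" "\<kappa> < 1" and t: "0 < t" "34 / (\<kappa> * t) \<le> \<epsilon>" "\<epsilon> \<le> 1"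
    and E: "\<And>x s a. 0 < L \<Longrightarrow> 0 \<le> s \<Longrightarrow> s < 1 / t \<Longrightarrow> a \<in> borel_measurable borel \<Longrightarrow>
      (\<integral>z. indicator (ball x \<epsilon>) z * (indicator {z. cmod z < 1 - s} z *
        \<bar>h (radial_shift s (z * cis (a (cmod z)))) - h (z * cis (a (cmod z)))\<bar>) \<partial>lborel) \<le> \<kappa> * L * pi * \<epsilon>\<^sup>2 / 2"
  shows "mix_scale \<kappa> (sol \<rho> t) \<le> \<epsilon>"
proof (rule mix_scale_leI)
  have "0 < 34 / (\<kappa> * t)" using \<kappa> t by simp
  then show \<epsilon>: "0 < \<epsilon>" using t by linarith
  have L: "0 \<le> L" using bnd[of 0] by linarith
  have "1 / t \<le> 34 / (\<kappa> * t)"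
    using \<kappa> t by (simp add: field_simps)
  then have t\<epsilon>: "1 / t \<le> \<epsilon>" using t by linarith
  fix x
  have [measurable]: "ball x r \<in> sets borel" "cball x r \<in> sets borel" for x :: complex and r by simp_all
  have E': "(\<integral>z. indicator (ball x \<epsilon>) z * (indicator {z. cmod z < 1 - s} z *
        \<bar>h (radial_shift s (z * cis (a (cmod z)))) - h (z * cis (a (cmod z)))\<bar>) \<partial>lborel) \<le> \<kappa> * L * pi * \<epsilon>\<^sup>2 / 2"
    if "0 \<le> s" "s < 1 / t" "a \<in> borel_measurable borel" for s a
  proof (cases "L = 0")
    case True
    then have "h z = 0" for z using bnd[of z] by simp
    then show ?thesis using True by simp
  next
    case False
    then show ?thesis using E[of s a x] that L by simp
  qed
  have "(LINT y:ball x \<epsilon>|lborel. indicator (cball 0 1) y * sol \<rho> t y) =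
      (\<integral>z. indicator (ball x \<epsilon>) z * h (z * cis (2 * pi * t * cmod z)) \<partial>lborel)"
    unfolding set_lebesgue_integral_def real_scaleR_def
  proof (rule integral_cong_AE)
    have "AE z in lborel. cmod (z * cis (2 * pi * t * cmod z)) < 1 \<longrightarrow>
        \<rho> (z * cis (2 * pi * t * cmod z)) = h (z * cis (2 * pi * t * cmod z))"
      by (rule AE_lborel_twist[OF eq]) measurable
    \<comment> \<open>The closed disk of \<open>mix_scale\<close> and the open one of h differ by
      the unit circle, a null set.\<close>
    moreover have "AE r in lborel. 0 < r \<longrightarrow> r \<noteq> (1::real)"
      using AE_lborel_singleton[of "1::real"] by eventually_elim auto
    then have "AE z in lborel. 0 < cmod z \<longrightarrow> cmod z \<noteq> 1"
      by (rule AE_cmod)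
    ultimately show "AE z in lborel. indicator (ball x \<epsilon>) z * (indicator (cball 0 1) z * sol \<rho> t z) =
        indicator (ball x \<epsilon>) z * h (z * cis (2 * pi * t * cmod z))"
    proof eventually_elim
      case (elim z)
      consider "cmod z < 1" | "1 < cmod z" using elim(2) by fastforce
      then show ?case
        using elim(1) supp[of "z * cis (2 * pi * t * cmod z)"]
        by cases (auto simp: sol_def norm_mult split: split_indicator)
    qed
  qed (unfold sol_def, measurable)
  also have "\<bar>\<dots>\<bar> \<le> 17 * pi * L * \<epsilon> / t + \<kappa> * L * pi * \<epsilon>\<^sup>2 / 2"
    using t t\<epsilon> E'
    by (intro twisted_integral_le[OF h bnd supp circle_mean_transfer[OF _ _ eq supp mean]]) auto
  also have "\<dots> \<le> \<kappa> * L * (pi * \<epsilon>\<^sup>2)"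
  proof -
    have "34 / t \<le> \<kappa> * \<epsilon>" using t \<kappa> by (simp add: field_simps)
    then have "(pi * L * \<epsilon> / 2) * (34 / t) \<le> (pi * L * \<epsilon> / 2) * (\<kappa> * \<epsilon>)"
      using L \<epsilon> by (intro mult_left_mono) auto
    moreover have "17 * pi * L * \<epsilon> / t = (pi * L * \<epsilon> / 2) * (34 / t)" by simp
    moreover have "\<kappa> * L * pi * \<epsilon>\<^sup>2 / 2 = (pi * L * \<epsilon> / 2) * (\<kappa> * \<epsilon>)"
      "\<kappa> * L * (pi * \<epsilon>\<^sup>2) = 2 * ((pi * L * \<epsilon> / 2) * (\<kappa> * \<epsilon>))"
      by (simp_all add: power2_eq_square)
    ultimately show ?thesis by linarith
  qed
  finally have "\<bar>LINT y:ball x \<epsilon>|lborel. indicator (cball 0 1) y * sol \<rho> t y\<bar> \<le> \<kappa> * L * measure lborel (ball x \<epsilon>)"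
    using \<epsilon> by (simp add: measure_ball_complex)
  then show "\<bar>(LINT y:ball x \<epsilon>|lborel. indicator (cball 0 1) y * sol \<rho> t y) / measure lborel (ball x \<epsilon>)\<bar>
      \<le> \<kappa> * Linf_B1 (sol \<rho> t)"
    using \<epsilon> by (simp add: Linf_B1_sol L_def measure_ball_complex abs_mult field_simps)
qed

lemma mix_scale_sol_le_continuous:
  fixes \<rho> g :: "complex \<Rightarrow> real" and \<kappa> :: real
  assumes \<rho>: "Linf_supp_B1 \<rho>"
    and mean: "AE r::real in lborel. 0 < r \<longrightarrow> (LBINT \<theta>=0..2*pi. \<rho> (of_real r * cis \<theta>) * r) = 0"
    and \<kappa>: "0 < \<kappa>" "\<kappa> < 1"
    and g: "continuous_on (cball 0 1) g" "AE x in lborel. x \<in> cball 0 1 \<longrightarrow> \<rho> x = g x"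
  shows "\<exists>Ct. \<forall>t\<ge>Ct. mix_scale \<kappa> (sol \<rho> t) \<le> 34 / \<kappa>\<^sup>2 * t powr (-1)"
proof -
  have [measurable]: "\<rho> \<in> borel_measurable borel" and ess: "\<exists>M. AE x in lborel. \<bar>\<rho> x\<bar> \<le> M"
    using \<rho> by (auto simp: Linf_supp_B1_def)
  define L where "L = Linf_B1 \<rho>"
  have L: "0 \<le> L" unfolding L_def by (rule Linf_B1_nonneg[OF ess])
  \<comment> \<open>Truncating the continuous representative, rather than \<rho>, keeps continuity
    inside the disk and gives the bound at every point.\<close>
  define h where "h = (\<lambda>z. indicator (ball 0 1) z *\<^sub>R max (-L) (min L (g z)))"
  have [measurable]: "h \<in> borel_measurable borel"
    unfolding h_def
    by (intro borel_measurable_continuous_on_indicator continuous_intros continuous_on_subset[OF g(1)]) auto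
  have bnd: "\<bar>h z\<bar> \<le> L" for z using L by (auto simp: h_def split: split_indicator)
  have supp: "1 \<le> cmod z \<Longrightarrow> h z = 0" for z by (simp add: h_def)
  have eq: "AE z in lborel. cmod z < 1 \<longrightarrow> \<rho> z = h z"
    using g(2) AE_le_Linf_B1[OF ess] by eventually_elim (auto simp: h_def L_def[symmetric])
  \<comment> \<open>A pointwise oscillation below \<kappa> L / 2 integrates over B to the allotted
    half. The value 1 for L = 0 is a placeholder that keeps e positive.\<close>
  define e where "e = (if L = 0 then 1 else \<kappa> * L / 2)"
  have "0 < e" using L \<kappa> by (auto simp: e_def)
  moreover have "uniformly_continuous_on (cball 0 1) g"
    by (rule compact_uniformly_continuous[OF g(1)]) simp
  ultimately obtain \<eta> where \<eta>: "0 < \<eta>" "\<And>x y. x \<in> cball 0 1 \<Longrightarrow> y \<in> cball 0 1 \<Longrightarrow> dist y x < \<eta> \<Longrightarrow> dist (g y) (g x) < e"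
    unfolding uniformly_continuous_on_def by metis
  show ?thesis
  \<comment> \<open>The first bound makes all shifts shorter than \<eta>, the second gives
    \<epsilon> \<le> 1.\<close>
  proof (intro exI[of _ "max (1 / \<eta>) (34 / \<kappa>)"] allI impI)
    fix t assume "max (1 / \<eta>) (34 / \<kappa>) \<le> t"
    then have t: "1 / \<eta> \<le> t" "34 / \<kappa> \<le> t" by auto
    have "0 < 34 / \<kappa>" using \<kappa> by simp
    then have t0: "0 < t" using t by linarith
    define \<epsilon> where "\<epsilon> = 34 / (\<kappa> * t)"
    have \<epsilon>: "0 < \<epsilon>" "\<epsilon> \<le> 1" using t t0 \<kappa> by (auto simp: \<epsilon>_def field_simps)
    have t\<eta>: "1 / t \<le> \<eta>" using t t0 \<eta> by (simp add: field_simps)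
    have "mix_scale \<kappa> (sol \<rho> t) \<le> \<epsilon>"
    proof (rule mix_scale_sol_le[where h = h])
      fix x s and a :: "real \<Rightarrow> real"
      assume Lpos: "0 < Linf_B1 \<rho>" and s: "0 \<le> s" "s < 1 / t" and [measurable]: "a \<in> borel_measurable borel"
      have [measurable]: "ball x r \<in> sets borel" for x :: complex and r by simp
      define w where "w = (\<lambda>z. z * cis (a (cmod z)))"
      have [measurable]: "w \<in> borel_measurable borel" unfolding w_def by measurable
      have "\<bar>h (radial_shift s (w z)) - h (w z)\<bar> \<le> \<kappa> * L / 2" if "cmod z < 1 - s" for z
      proof -
        have w: "cmod (w z) < 1 - s" using that by (simp add: w_def norm_mult)
        have d: "dist (radial_shift s (w z)) (w z) \<le> s" by (rule dist_radial_shift[OF s(1)])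
        then have "cmod (radial_shift s (w z)) \<le> cmod (w z) + s"
          unfolding dist_norm using norm_triangle_ineq2[of "radial_shift s (w z)" "w z"] by linarith
        then have w1: "cmod (radial_shift s (w z)) < 1" using w by simp
        have "dist (g (radial_shift s (w z))) (g (w z)) < e"
          using w w1 d s t\<eta> by (intro \<eta>(2)) auto
        then have "\<bar>g (radial_shift s (w z)) - g (w z)\<bar> < \<kappa> * L / 2"
          using Lpos by (simp add: e_def L_def dist_real_def)
        moreover have "h (radial_shift s (w z)) = max (-L) (min L (g (radial_shift s (w z))))"
          "h (w z) = max (-L) (min L (g (w z)))"
          using w w1 s by (auto simp: h_def)
        ultimately show ?thesis by linarith
      qed
      then have pw: "indicator (ball x \<epsilon>) z * (indicator {z. cmod z < 1 - s} z * \<bar>h (radial_shift s (w z)) - h (w z)\<bar>)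
          \<le> indicator (ball x \<epsilon>) z * (\<kappa> * L / 2)" for z
        using L \<kappa> by (auto split: split_indicator)
      have "(\<integral>z. indicator (ball x \<epsilon>) z * (indicator {z. cmod z < 1 - s} z * \<bar>h (radial_shift s (w z)) - h (w z)\<bar>) \<partial>lborel)
         \<le> (\<integral>z. indicator (ball x \<epsilon>) z * (\<kappa> * L / 2) \<partial>lborel)"
      proof (rule integral_mono[OF _ _ pw])
        show "integrable lborel (\<lambda>z. indicator (ball x \<epsilon>) z * (indicator {z. cmod z < 1 - s} z * \<bar>h (radial_shift s (w z)) - h (w z)\<bar>))"
          by (rule integrable_bounded_on_ball[where M = "\<kappa> * L / 2" and x = x and r = \<epsilon>])
             (measurable, use pw in \<open>auto simp: mult.commute\<close>)
      qed (intro integrable_mult_left integrable_indicator_ball)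
      also have "\<dots> = \<kappa> * L * pi * \<epsilon>\<^sup>2 / 2"
        using \<epsilon> by (simp add: measure_ball_complex)
      finally show "(\<integral>z. indicator (ball x \<epsilon>) z * (indicator {z. cmod z < 1 - s} z *
          \<bar>h (radial_shift s (z * cis (a (cmod z)))) - h (z * cis (a (cmod z)))\<bar>) \<partial>lborel) \<le> \<kappa> * Linf_B1 \<rho> * pi * \<epsilon>\<^sup>2 / 2"
        by (simp add: w_def L_def)
    qed (use eq bnd supp mean \<kappa> t0 \<epsilon> in \<open>auto simp: L_def[symmetric] \<epsilon>_def\<close>)
    \<comment> \<open>The bound obtained is 34/(\<kappa> t); \<kappa> < 1 gives the form with
      \<kappa>^2.\<close>
    also have "\<epsilon> \<le> 34 / \<kappa>\<^sup>2 * t powr (-1)"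
      using \<kappa> t0 by (simp add: \<epsilon>_def powr_minus_divide power2_eq_square field_simps)
    finally show "mix_scale \<kappa> (sol \<rho> t) \<le> 34 / \<kappa>\<^sup>2 * t powr (-1)" .
  qed
qed

section \<open>Fractional and weak differentiability\<close>

lemma osc_cong_AE:
  assumes "AE z in lborel. cmod z < 1 \<longrightarrow> f z = g z"
  shows "osc f d = osc g d"
  unfolding osc_def
proof (rule nn_integral_cong_AE, use assms in eventually_elim)
  case (elim z)
  show ?case
    by (rule nn_integral_cong_AE, use assms in eventually_elim) (use elim in \<open>auto split: split_indicator\<close>)
qed

text \<open>For \<alpha> < 1 the kernel bound is applied to \<rho> itself; for \<alpha> = 1 the
  translation bound is applied to the bounded representative h and gives pi d^3. The factor pi puts
  both cases into one formula.\<close>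

lemma osc_le_W_seminorm:
  fixes \<rho> h :: "complex \<Rightarrow> real"
  assumes [measurable]: "\<rho> \<in> borel_measurable borel" and h [measurable]: "h \<in> borel_measurable borel"
    and eq: "AE z in lborel. cmod z < 1 \<longrightarrow> \<rho> z = h z"
    and bnd: "\<And>z. \<bar>h z\<bar> \<le> L" and \<alpha>: "0 < \<alpha>" "\<alpha> \<le> 1" and d: "0 < d"
    and W: "W_alpha_1_seminorm \<alpha> \<rho> = ennreal W"
  shows "osc h d \<le> ennreal (pi * d powr (2 + \<alpha>)) * ennreal W"
proof (cases "\<alpha> < 1")
  case True
  have "osc h d = osc \<rho> d" by (rule osc_cong_AE[OF eq, symmetric])
  also have "\<dots> \<le> ennreal (d powr (2 + \<alpha>)) * ennreal W"
    unfolding W[symmetric] using \<alpha> True d by (intro osc_le_fractional_seminorm) auto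
  also have "\<dots> \<le> ennreal (pi * d powr (2 + \<alpha>)) * ennreal W"
    using pi_gt3 mult_right_mono[of 1 pi "d powr (2 + \<alpha>)"] by (intro mult_right_mono ennreal_leI) auto
  finally show ?thesis .
next
  case False
  then have "\<alpha> = 1" using \<alpha> by simp
  \<comment> \<open>A finite seminorm excludes the value \<infinity> assigned in the absence of a
    weak gradient, so the pair picked by \<open>SOME\<close> is a weak gradient.\<close>
  have ex: "\<exists>g1 g2. weak_grad_B1 \<rho> g1 g2"
    using W \<open>\<alpha> = 1\<close> by (auto simp: W_alpha_1_seminorm_def split: if_splits)
  obtain g1 g2 where some: "(SOME (g1, g2). weak_grad_B1 \<rho> g1 g2) = (g1, g2)" by fastforce
  have "case (SOME (g1, g2). weak_grad_B1 \<rho> g1 g2) of (g1, g2) \<Rightarrow> weak_grad_B1 \<rho> g1 g2"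
    by (rule someI_ex) (use ex in auto)
  then have weak: "weak_grad_B1 \<rho> g1 g2" by (simp add: some)
  have W': "(\<integral>\<^sup>+x. indicator (ball 0 1) x * ennreal (sqrt ((g1 x)\<^sup>2 + (g2 x)\<^sup>2)) \<partial>lborel) = ennreal W"
    using W ex \<open>\<alpha> = 1\<close> by (simp add: W_alpha_1_seminorm_def some)
  have [measurable]: "g1 \<in> borel_measurable borel" "g2 \<in> borel_measurable borel"
    using weak by (auto simp: weak_grad_B1_def)
  have cong: "(LINT x:ball 0 1|lborel. h x * k x) = (LINT x:ball 0 1|lborel. \<rho> x * k x)"
    if [measurable]: "k \<in> borel_measurable borel" for k
    unfolding set_lebesgue_integral_def
  proof (rule integral_cong_AE)
    show "AE x in lborel. indicat_real (ball 0 1) x *\<^sub>R (h x * k x) = indicat_real (ball 0 1) x *\<^sub>R (\<rho> x * k x)"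
      using eq by eventually_elim (auto split: split_indicator)
    have [measurable]: "ball x r \<in> sets borel" for x :: complex and r by simp
    show "(\<lambda>x. indicat_real (ball 0 1) x *\<^sub>R (h x * k x)) \<in> borel_measurable lborel"
      "(\<lambda>x. indicat_real (ball 0 1) x *\<^sub>R (\<rho> x * k x)) \<in> borel_measurable lborel" by measurable
  qed
  have "osc h d \<le> ennreal (pi * d ^ 3) * ennreal W"
  proof (rule osc_le_translations)
    fix v
    show "(\<integral>\<^sup>+z. indicator (ball 0 1) z * indicator (ball 0 1) (z + v) * ennreal \<bar>h (z + v) - h z\<bar> \<partial>lborel)
        \<le> ennreal (cmod v) * ennreal W"
      unfolding W'[symmetric]
    proof (rule translation_diff_le_weak_gradient[OF h bnd])
      fix \<phi> assume \<phi>: "test_fun_B1 \<phi>"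
      then have [measurable]: "(\<lambda>x. frechet_derivative \<phi> (at x) 1) \<in> borel_measurable borel"
        "(\<lambda>x. frechet_derivative \<phi> (at x) \<i>) \<in> borel_measurable borel"
        by (auto simp: test_fun_B1_def intro: borel_measurable_continuous_onI)
      show "(LINT x:ball 0 1|lborel. h x * frechet_derivative \<phi> (at x) 1) = - (LINT x:ball 0 1|lborel. g1 x * \<phi> x) \<and>
        (LINT x:ball 0 1|lborel. h x * frechet_derivative \<phi> (at x) \<i>) = - (LINT x:ball 0 1|lborel. g2 x * \<phi> x)"
        using weak \<phi> by (subst (1 2) cong) (auto simp: weak_grad_B1_def)
    qed (auto simp: W')
  qed (use d in auto)
  also have "d ^ 3 = d powr (2 + \<alpha>)"
    using d \<open>\<alpha> = 1\<close> by (simp add: powr_numeral)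
  finally show ?thesis .
qed

text \<open>Dropping the disk and undoing the measure-preserving twist leaves an integral
  independent of x, \<epsilon> and \<open>a\<close>. The constant is 64 = 4 * 2 * 8: the averaging
  disk of area pi \<delta>^2 / 4, the two endpoints of a shift, and
  \<open>2 powr (2 + \<alpha>)\<close> \<le> 8.\<close>

lemma radial_shift_diff_le_W_seminorm:
  fixes \<rho> h :: "complex \<Rightarrow> real"
  assumes \<rho> [measurable]: "\<rho> \<in> borel_measurable borel" and h [measurable]: "h \<in> borel_measurable borel"
    and eq: "AE z in lborel. cmod z < 1 \<longrightarrow> \<rho> z = h z"
    and bnd: "\<And>z. \<bar>h z\<bar> \<le> L" and \<alpha>: "0 < \<alpha>" "\<alpha> \<le> 1"
    and W: "W_alpha_1_seminorm \<alpha> \<rho> = ennreal W" "0 \<le> W"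
    and s: "0 \<le> s" "s \<le> \<delta>" and \<delta>: "0 < \<delta>" "\<delta> \<le> 1" and [measurable]: "a \<in> borel_measurable borel"
  shows "(\<integral>z. indicator (ball x \<epsilon>) z * (indicator {z. cmod z < 1 - s} z *
      \<bar>h (radial_shift s (z * cis (a (cmod z)))) - h (z * cis (a (cmod z)))\<bar>) \<partial>lborel) \<le> 64 * W * \<delta> powr \<alpha>"
    (is "?X \<le> _")
proof -
  let ?S = "radial_shift s"
  have [measurable]: "ball x r \<in> sets borel" for x :: complex and r by simp
  define w where "w = (\<lambda>z. z * cis (a (cmod z)))"
  have [measurable]: "w \<in> borel_measurable borel" unfolding w_def by measurable
  have cw: "cmod (w z) = cmod z" for z by (simp add: w_def norm_mult)
  define D where "D = (\<lambda>z. indicator (ball x \<epsilon>) z * (indicator {z. cmod z < 1 - s} z * \<bar>h (?S (w z)) - h (w z)\<bar>))"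
  have [measurable]: "D \<in> borel_measurable borel" unfolding D_def by measurable
  have D_le: "\<bar>D z\<bar> \<le> (2 * L) * indicator (ball x \<epsilon>) z" for z
    using bnd[of "?S (w z)"] bnd[of "w z"] by (auto simp: D_def split: split_indicator)
  have D_int: "integrable lborel D"
    by (rule integrable_bounded_on_ball[OF _ D_le]) measurable
  define k where "k = (\<lambda>z. indicator {z. cmod z < 1 - s} z * ennreal \<bar>h (?S z) - h z\<bar>)"
  have [measurable]: "k \<in> borel_measurable borel" unfolding k_def by measurable
  have X: "?X = (\<integral>z. D z \<partial>lborel)" by (simp add: D_def w_def)
  have X0: "0 \<le> ?X" unfolding X by (rule Bochner_Integration.integral_nonneg) (auto simp: D_def)
  have "ennreal ?X = (\<integral>\<^sup>+z. ennreal (D z) \<partial>lborel)"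
    unfolding X by (rule nn_integral_eq_integral[OF D_int, symmetric]) (auto simp: D_def)
  also have "\<dots> \<le> (\<integral>\<^sup>+z. k (w z) \<partial>lborel)"
    by (rule nn_integral_mono) (auto simp: D_def k_def cw split: split_indicator)
  also have "\<dots> = (\<integral>\<^sup>+z. k z \<partial>distr lborel borel w)"
    by (rule nn_integral_distr[symmetric]) measurable
  also have "distr lborel borel w = lborel"
    unfolding w_def by (rule lborel_distr_twist) measurable
  finally have "ennreal ?X * ennreal (pi * \<delta>\<^sup>2 / 4) \<le> (\<integral>\<^sup>+z. k z \<partial>lborel) * ennreal (pi * \<delta>\<^sup>2 / 4)"
    by (rule mult_right_mono) simp
  also have "\<dots> \<le> 2 * osc h (2 * \<delta>)"
    unfolding k_def by (rule radial_shift_diff_le_osc[OF h s \<delta>])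
  also have "\<dots> \<le> 2 * (ennreal (pi * (2 * \<delta>) powr (2 + \<alpha>)) * ennreal W)"
    using \<delta> by (intro mult_left_mono osc_le_W_seminorm[OF \<rho> h eq bnd \<alpha> _ W(1)]) auto
  also have "\<dots> = ennreal (2 * (pi * (2 * \<delta>) powr (2 + \<alpha>) * W))"
    using W by (simp add: ennreal_mult)
  finally have "ennreal (?X * (pi * \<delta>\<^sup>2 / 4)) \<le> ennreal (2 * (pi * (2 * \<delta>) powr (2 + \<alpha>) * W))"
    using X0 by (subst ennreal_mult) auto
  then have "?X * (pi * \<delta>\<^sup>2 / 4) \<le> 2 * (pi * (2 * \<delta>) powr (2 + \<alpha>) * W)"
    using W by (subst (asm) ennreal_le_iff) auto
  also have "(2 * \<delta>) powr (2 + \<alpha>) = 2 powr (2 + \<alpha>) * (\<delta>\<^sup>2 * \<delta> powr \<alpha>)"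
    using \<delta> by (simp add: powr_mult powr_add powr_numeral)
  also have "2 * (pi * (2 powr (2 + \<alpha>) * (\<delta>\<^sup>2 * \<delta> powr \<alpha>)) * W) =
      2 powr (2 + \<alpha>) * (2 * pi * \<delta>\<^sup>2 * \<delta> powr \<alpha> * W)" by simp
  also have "\<dots> \<le> 8 * (2 * pi * \<delta>\<^sup>2 * \<delta> powr \<alpha> * W)"
  proof (rule mult_right_mono)
    have "2 powr (2 + \<alpha>) \<le> (2::real) powr 3" using \<alpha> by (intro powr_mono) auto
    then show "2 powr (2 + \<alpha>) \<le> (8::real)" by simp
  qed (use W in auto)
  also have "\<dots> = (64 * W * \<delta> powr \<alpha>) * (pi * \<delta>\<^sup>2 / 4)" by simp
  finally show ?thesis
    using \<delta> by (subst (asm) mult_le_cancel_right_pos) auto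
qed

lemma mix_scale_sol_le_W_seminorm:
  fixes \<alpha> \<kappa> W L :: real
  assumes \<alpha>: "0 < \<alpha>" "\<alpha> \<le> 1" and \<kappa>: "0 < \<kappa>" "\<kappa> < 1"
  shows "\<exists>C1 C2. \<forall>\<rho>.
      Linf_supp_B1 \<rho> \<and>
      (AE r::real in lborel. 0 < r \<longrightarrow> (LBINT \<theta>=0..2*pi. \<rho> (of_real r * cis \<theta>) * r) = 0) \<and>
      W_alpha_1_seminorm \<alpha> \<rho> = ennreal W \<and> Linf_B1 \<rho> = L
      \<longrightarrow> (\<forall>t\<ge>C2. mix_scale \<kappa> (sol \<rho> t) \<le> C1 * t powr (-\<alpha>/2))"
proof -
  \<comment> \<open>\<open>ennreal\<close> sends negative W to 0, and so does this
    truncation.\<close>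
  define W' where "W' = max 0 W"
  \<comment> \<open>The first summand makes \<epsilon> at least 34/(\<kappa> t), as t^(-1) \<le>
    t^(-\<alpha>/2) for t \<ge> 1; the second, squared, makes 64 W' t^(-\<alpha>) at most half of
    \<kappa> L pi \<epsilon>^2. For L = 0 the second is 0.\<close>
  define C1 where "C1 = 34 / \<kappa> + sqrt (128 * W' / (\<kappa> * L * pi))"
  \<comment> \<open>From this time on \<epsilon> \<le> 1. The absolute value covers arbitrary real
    L, for which C1 may be negative.\<close>
  define C2 where "C2 = max 1 (\<bar>C1\<bar> powr (2 / \<alpha>))"
  show ?thesis
  proof (rule exI[of _ C1], rule exI[of _ C2], intro allI impI, elim conjE)
    fix \<rho> t
    assume \<rho>: "Linf_supp_B1 \<rho>"
      and mean: "AE r::real in lborel. 0 < r \<longrightarrow> (LBINT \<theta>=0..2*pi. \<rho> (of_real r * cis \<theta>) * r) = 0"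
      and W: "W_alpha_1_seminorm \<alpha> \<rho> = ennreal W" and L: "Linf_B1 \<rho> = L" and t: "C2 \<le> t"
    have [measurable]: "\<rho> \<in> borel_measurable borel" and ess: "\<exists>M. AE x in lborel. \<bar>\<rho> x\<bar> \<le> M"
      using \<rho> by (auto simp: Linf_supp_B1_def)
    have L0: "0 \<le> L" unfolding L[symmetric] by (rule Linf_B1_nonneg[OF ess])
    have W': "W_alpha_1_seminorm \<alpha> \<rho> = ennreal W'" "0 \<le> W'"
      using W by (auto simp: W'_def max_def ennreal_neg)
    \<comment> \<open>No continuity is to be preserved here, so values above the essential bound are
      set to 0.\<close>
    define h where "h = (\<lambda>z. if cmod z < 1 \<and> \<bar>\<rho> z\<bar> \<le> L then \<rho> z else 0)"
    have h [measurable]: "h \<in> borel_measurable borel" unfolding h_def by measurable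
    have bnd: "\<bar>h z\<bar> \<le> L" for z using L0 by (auto simp: h_def)
    have supp: "1 \<le> cmod z \<Longrightarrow> h z = 0" for z by (simp add: h_def)
    have eq: "AE z in lborel. cmod z < 1 \<longrightarrow> \<rho> z = h z"
      using AE_le_Linf_B1[OF ess] by eventually_elim (auto simp: h_def L)
    have C1: "34 / \<kappa> \<le> C1" "sqrt (128 * W' / (\<kappa> * L * pi)) \<le> C1"
      using \<kappa> L0 W' by (auto simp: C1_def)
    have "0 < 34 / \<kappa>" using \<kappa> by simp
    then have C1_pos: "0 < C1" using C1 by linarith
    have t1: "1 \<le> t" and tC: "C1 powr (2 / \<alpha>) \<le> t" using t C1_pos by (auto simp: C2_def)
    define \<epsilon> where "\<epsilon> = C1 * t powr (-\<alpha>/2)"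
    have "C1 = (C1 powr (2 / \<alpha>)) powr (\<alpha> / 2)"
      using C1_pos \<alpha> by (simp add: powr_powr)
    also have "\<dots> \<le> t powr (\<alpha> / 2)"
      using tC \<alpha> by (intro powr_mono2) auto
    finally have \<epsilon>1: "\<epsilon> \<le> 1"
      using t1 by (simp add: \<epsilon>_def powr_minus_divide)
    have "34 / (\<kappa> * t) = (34 / \<kappa>) * t powr (-1)"
      using t1 by (simp add: powr_minus_divide)
    also have "\<dots> \<le> C1 * t powr (-\<alpha>/2)"
      using C1 C1_pos t1 \<alpha> by (intro mult_mono powr_mono) auto
    finally have t\<epsilon>: "34 / (\<kappa> * t) \<le> \<epsilon>" by (simp add: \<epsilon>_def)
    have "mix_scale \<kappa> (sol \<rho> t) \<le> \<epsilon>"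
    proof (rule mix_scale_sol_le[where h = h])
      fix x s and a :: "real \<Rightarrow> real"
      assume "0 < Linf_B1 \<rho>" and s: "0 \<le> s" "s < 1 / t" and a: "a \<in> borel_measurable borel"
      then have Lpos: "0 < L" by (simp add: L)
      have "(\<integral>z. indicator (ball x \<epsilon>) z * (indicator {z. cmod z < 1 - s} z *
          \<bar>h (radial_shift s (z * cis (a (cmod z)))) - h (z * cis (a (cmod z)))\<bar>) \<partial>lborel) \<le> 64 * W' * (1 / t) powr \<alpha>"
        using s t1 by (intro radial_shift_diff_le_W_seminorm[OF _ h eq bnd \<alpha> W' _ _ _ _ a]) auto
      also have "(1 / t) powr \<alpha> = (t powr (-\<alpha>/2))\<^sup>2"
        using t1 by (simp add: powr_divide powr_minus_divide power2_eq_square powr_add[symmetric])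
      also have "64 * W' * (t powr (-\<alpha>/2))\<^sup>2 \<le> (\<kappa> * L * pi / 2 * C1\<^sup>2) * (t powr (-\<alpha>/2))\<^sup>2"
      proof (rule mult_right_mono)
        have "128 * W' / (\<kappa> * L * pi) \<le> C1\<^sup>2"
          using C1(2) C1_pos by (simp add: real_sqrt_le_iff' sqrt_le_D)
        then show "64 * W' \<le> \<kappa> * L * pi / 2 * C1\<^sup>2"
          using \<kappa> Lpos by (simp add: field_simps)
      qed simp
      also have "\<dots> = \<kappa> * Linf_B1 \<rho> * pi * \<epsilon>\<^sup>2 / 2"
        by (simp add: \<epsilon>_def power_mult_distrib L)
      finally show "(\<integral>z. indicator (ball x \<epsilon>) z * (indicator {z. cmod z < 1 - s} z *
          \<bar>h (radial_shift s (z * cis (a (cmod z)))) - h (z * cis (a (cmod z)))\<bar>) \<partial>lborel) \<le> \<kappa> * Linf_B1 \<rho> * pi * \<epsilon>\<^sup>2 / 2" .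
    qed (use eq bnd supp mean \<kappa> t1 \<epsilon>1 t\<epsilon> in \<open>auto simp: L\<close>)
    then show "mix_scale \<kappa> (sol \<rho> t) \<le> C1 * t powr (-\<alpha>/2)"
      by (simp add: \<epsilon>_def)
  qed
qed

theorem theorem2:
  shows
   "(\<exists>C>0. \<forall>\<rho>0 \<kappa>.
       Linf_supp_B1 \<rho>0 \<and>
       (AE r::real in lborel. 0 < r \<longrightarrow> (LBINT \<theta>=0..2*pi. \<rho>0 (of_real r * cis \<theta>) * r) = 0) \<and>
       0 < \<kappa> \<and> \<kappa> < 1 \<and>
       (\<exists>g. continuous_on (cball 0 1) g \<and> (AE x in lborel. x \<in> cball 0 1 \<longrightarrow> \<rho>0 x = g x))
       \<longrightarrow> (\<exists>Ct. \<forall>t\<ge>Ct. mix_scale \<kappa> (sol \<rho>0 t) \<le> C / \<kappa>\<^sup>2 * t powr (-1)))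
    \<and>
    (\<forall>\<alpha> \<kappa> W L. 0 < \<alpha> \<and> \<alpha> \<le> 1 \<and> 0 < \<kappa> \<and> \<kappa> < 1 \<longrightarrow>
       (\<exists>C1 C2. \<forall>\<rho>0.
          Linf_supp_B1 \<rho>0 \<and>
          (AE r::real in lborel. 0 < r \<longrightarrow> (LBINT \<theta>=0..2*pi. \<rho>0 (of_real r * cis \<theta>) * r) = 0) \<and>
          W_alpha_1_seminorm \<alpha> \<rho>0 = ennreal W \<and> Linf_B1 \<rho>0 = L
          \<longrightarrow> (\<forall>t\<ge>C2. mix_scale \<kappa> (sol \<rho>0 t) \<le> C1 * t powr (-\<alpha>/2))))"
proof
  show "\<exists>C>0. \<forall>\<rho>0 \<kappa>.
       Linf_supp_B1 \<rho>0 \<and>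
       (AE r::real in lborel. 0 < r \<longrightarrow> (LBINT \<theta>=0..2*pi. \<rho>0 (of_real r * cis \<theta>) * r) = 0) \<and>
       0 < \<kappa> \<and> \<kappa> < 1 \<and>
       (\<exists>g. continuous_on (cball 0 1) g \<and> (AE x in lborel. x \<in> cball 0 1 \<longrightarrow> \<rho>0 x = g x))
       \<longrightarrow> (\<exists>Ct. \<forall>t\<ge>Ct. mix_scale \<kappa> (sol \<rho>0 t) \<le> C / \<kappa>\<^sup>2 * t powr (-1))"
  proof (rule exI[of _ "34::real"], rule conjI)
    show "\<forall>\<rho>0 \<kappa>.
       Linf_supp_B1 \<rho>0 \<and>
       (AE r::real in lborel. 0 < r \<longrightarrow> (LBINT \<theta>=0..2*pi. \<rho>0 (of_real r * cis \<theta>) * r) = 0) \<and>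
       0 < \<kappa> \<and> \<kappa> < 1 \<and>
       (\<exists>g. continuous_on (cball 0 1) g \<and> (AE x in lborel. x \<in> cball 0 1 \<longrightarrow> \<rho>0 x = g x))
       \<longrightarrow> (\<exists>Ct. \<forall>t\<ge>Ct. mix_scale \<kappa> (sol \<rho>0 t) \<le> 34 / \<kappa>\<^sup>2 * t powr (-1))"
      by (rule allI, rule allI, rule impI, elim conjE exE) (rule mix_scale_sol_le_continuous)
  qed simp
qed (intro allI impI mix_scale_sol_le_W_seminorm; simp)

end
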